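(* The set $$\mathcal R:=\{A\in C^\alpha(\Sigma,\mathbb R):\ \mathcal M(A)=\{\mu\}\text{ for some }\mu,\ \mathcal A(A)=\operatorname{supp}(\mu)\}$$ contains a residual subset of $C^\alpha(\Sigma,\mathbb R)$.
   Context: $\Sigma=\{1,\dots,d\}^{\mathbb N}$, $T$ the left shift, metric $d(\omega,\nu)=\lambda^N$, $N=\min\{k:\omega_k\ne\nu_k\}$, $0<\lambda<1$; $C^\alpha(\Sigma,\mathbb R)$ carries the norm $\|F\|_\alpha=\sup|F|+\sup_{x\ne y}|F(x)-F(y)|/d(x,y)^\alpha$. $m_A=\max\{\int A\,d\mu:\mu\ T\text{-invariant}\}$ and $\mathcal M(A)$ is the set of $T$-invariant probabilities with $\int A\,d\mu=m_A$. Mañé potential $S_A(x,y)=\lim_{\epsilon\to0}\sup\{\sum_{i=0}^{n-1}[A(T^iz)-m_A]:n\in\mathbb N,\ T^nz=y,\ d(z,x)<\epsilon\}$; Aubry set $\mathcal A(A)=\{x:S_A(x,x)=0\}$. *)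

theory Defs
  imports "HOL-Probability.Probability"
begin

definition Sig :: "nat \<Rightarrow> (nat \<Rightarrow> nat) set" where
  "Sig d = {\<omega>. \<forall>k. \<omega> k \<in> {1..d}}"

definition shift :: "(nat \<Rightarrow> nat) \<Rightarrow> (nat \<Rightarrow> nat)" where
  "shift \<omega> = (\<lambda>k. \<omega> (Suc k))"

definition sdist :: "real \<Rightarrow> (nat \<Rightarrow> nat) \<Rightarrow> (nat \<Rightarrow> nat) \<Rightarrow> real" where
  "sdist lam \<omega> \<nu> = (if \<omega> = \<nu> then 0 else lam ^ (LEAST k. \<omega> k \<noteq> \<nu> k))"

definition holder_quots :: "nat \<Rightarrow> real \<Rightarrow> real \<Rightarrow> ((nat \<Rightarrow> nat) \<Rightarrow> real) \<Rightarrow> real set" where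
  "holder_quots d lam \<alpha> A =
     {\<bar>A x - A y\<bar> / (sdist lam x y powr \<alpha>) | x y. x \<in> Sig d \<and> y \<in> Sig d \<and> x \<noteq> y}"

definition holder_norm :: "nat \<Rightarrow> real \<Rightarrow> real \<Rightarrow> ((nat \<Rightarrow> nat) \<Rightarrow> real) \<Rightarrow> real" where
  "holder_norm d lam \<alpha> A = (SUP x\<in>Sig d. \<bar>A x\<bar>) + Sup (insert 0 (holder_quots d lam \<alpha> A))"

definition Calpha :: "nat \<Rightarrow> real \<Rightarrow> real \<Rightarrow> ((nat \<Rightarrow> nat) \<Rightarrow> real) set" where
  "Calpha d lam \<alpha> = {A. (\<forall>x. x \<notin> Sig d \<longrightarrow> A x = 0)
      \<and> bdd_above ((\<lambda>x. \<bar>A x\<bar>) ` Sig d) \<and> bdd_above (holder_quots d lam \<alpha> A)}"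

definition inv_probs :: "nat \<Rightarrow> (nat \<Rightarrow> nat) measure set" where
  "inv_probs d = {\<mu>. prob_space \<mu> \<and> sets \<mu> = sets (restrict_space borel (Sig d))
      \<and> (\<forall>B\<in>sets \<mu>. emeasure \<mu> (shift -` B \<inter> Sig d) = emeasure \<mu> B)}"

definition mA :: "nat \<Rightarrow> ((nat \<Rightarrow> nat) \<Rightarrow> real) \<Rightarrow> real" where
  "mA d A = Sup {integral\<^sup>L \<mu> A | \<mu>. \<mu> \<in> inv_probs d}"

definition maxmeas :: "nat \<Rightarrow> ((nat \<Rightarrow> nat) \<Rightarrow> real) \<Rightarrow> (nat \<Rightarrow> nat) measure set" where
  "maxmeas d A = {\<mu> \<in> inv_probs d. integral\<^sup>L \<mu> A = mA d A}"

definition mane :: "nat \<Rightarrow> real \<Rightarrow> ((nat \<Rightarrow> nat) \<Rightarrow> real) \<Rightarrow> (nat \<Rightarrow> nat) \<Rightarrow> (nat \<Rightarrow> nat) \<Rightarrow> ereal" where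
  "mane d lam A x y = Lim (at_right (0::real))
     (\<lambda>\<epsilon>. Sup {ereal (\<Sum>i<n. (A ((shift ^^ i) z) - mA d A)) | n z.
                 n \<ge> 1 \<and> z \<in> Sig d \<and> (shift ^^ n) z = y \<and> sdist lam z x < \<epsilon>})"

definition aubry :: "nat \<Rightarrow> real \<Rightarrow> ((nat \<Rightarrow> nat) \<Rightarrow> real) \<Rightarrow> (nat \<Rightarrow> nat) set" where
  "aubry d lam A = {x \<in> Sig d. mane d lam A x x = 0}"

definition supp :: "nat \<Rightarrow> real \<Rightarrow> (nat \<Rightarrow> nat) measure \<Rightarrow> (nat \<Rightarrow> nat) set" where
  "supp d lam \<mu> = {x \<in> Sig d. \<forall>e>0. emeasure \<mu> {y \<in> Sig d. sdist lam x y < e} > 0}"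

definition contains_residual :: "('b \<Rightarrow> real) set \<Rightarrow> (('b \<Rightarrow> real) \<Rightarrow> real) \<Rightarrow> ('b \<Rightarrow> real) set \<Rightarrow> bool" where
  "contains_residual C N R = (\<exists>G :: nat \<Rightarrow> ('b \<Rightarrow> real) set.
     (\<forall>n. G n \<subseteq> C
        \<and> (\<forall>A\<in>G n. \<exists>e>0. \<forall>B\<in>C. N (\<lambda>x. B x - A x) < e \<longrightarrow> B \<in> G n)
        \<and> (\<forall>A\<in>C. \<forall>e>0. \<exists>B\<in>G n. N (\<lambda>x. B x - A x) < e))
     \<and> (\<Inter>n. G n) \<subseteq> R)"

end

(* Let mu maximize the integral of A0 plus kappa times the strictly convex functional
   sum_w nu[w]^2, w ranging over the words of length at most r.  Adding the derivative of that
   functional at mu to A0 makes mu uniquely maximizing, with a quadratic gap.  Subtracting a small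
   multiple of the indicator of the k-cylinders that are null for mu gives the centre A of a ball
   on which all maximizing measures are close to mu and the Aubry set meets only k-cylinders
   charged by mu.  For the latter, a point of the Aubry set of a nearby B is shadowed by periodic
   orbits whose normalised Birkhoff sum is almost 0.  Cutting out everything between the first and
   the last visit to a cylinder [u] with |u| = r and mu[u] > 0 leaves a periodic orbit that visits
   [u] at most once.  The gap bounds its length in terms of mu[u], so the penalty paid once on this
   orbit outweighs the effect of the perturbation B - A, a contradiction. *)
theory Submission
  imports Defs
begin

text \<open>The obstacle is that measures do not see all of the Aubry set: an excursion homoclinic
  to the support can have total loss zero although it carries no mass, so uniqueness of the
  maximizing measure does not suffice. The penalty is paid only once per excursion, while the error
  caused by B - A accumulates at every step, and the shadowing orbits can be arbitrarily long
  because they may linger near the support. Excision removes this lingering at a cost that depends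
  on the agreement on r symbols and not on the length removed.

  The order of the choices avoids a circle. The size of the penalty precedes r, because the excision
  error must be small against it; r precedes the convex term and hence mu. Only then is the mass
  mu[u] known. It may be tiny, but it enters only the radius of the ball, which is chosen last.

  The inclusion of the support in the Aubry set is proved for every potential and every maximizing
  measure. Intersecting over all k turns the approximate conditions into uniqueness and into the
  other inclusion.\<close>

abbreviation agree :: "nat \<Rightarrow> (nat \<Rightarrow> nat) \<Rightarrow> (nat \<Rightarrow> nat) \<Rightarrow> bool" where
  "agree n x y \<equiv> \<forall>i<n. x i = y i"

abbreviation pre :: "nat \<Rightarrow> (nat \<Rightarrow> nat) \<Rightarrow> nat list" where
  "pre n x \<equiv> map x [0..<n]"

lemma funpow_shift: "(shift ^^ n) x = (\<lambda>k. x (n + k))"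
  by (induction n arbitrary: x) (auto simp: shift_def)

lemma Sig_shift: "x \<in> Sig d \<Longrightarrow> (shift ^^ n) x \<in> Sig d"
  by (simp add: Sig_def funpow_shift)

definition bsum :: "((nat \<Rightarrow> nat) \<Rightarrow> real) \<Rightarrow> nat \<Rightarrow> (nat \<Rightarrow> nat) \<Rightarrow> real" where
  "bsum f n x = (\<Sum>i<n. f ((shift ^^ i) x))"

lemma bsum_0 [simp]: "bsum f 0 x = 0"
  by (simp add: bsum_def)

lemma bsum_Suc: "bsum f (Suc n) x = f x + bsum f n (shift x)"
  unfolding bsum_def sum.lessThan_Suc_shift by (simp add: funpow_swap1)

lemma bsum_add: "bsum f (m + n) x = bsum f m x + bsum f n ((shift ^^ m) x)"
proof (induction m arbitrary: x)
  case (Suc m)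
  then show ?case by (simp add: bsum_Suc funpow_swap1)
qed simp

lemma bsum_split: "m \<le> n \<Longrightarrow> bsum f n x = bsum f m x + bsum f (n - m) ((shift ^^ m) x)"
  using bsum_add[of f m "n - m" x] by simp

lemma bsum_linear: "bsum (\<lambda>x. f x + c * g x) n x = bsum f n x + c * bsum g n x"
  by (simp add: bsum_def sum.distrib sum_distrib_left)

text \<open>Closing up a pseudo-orbit: repeating the word between two visits to the same cylinder
  gains the full length of that word in precision.\<close>
lemma closing:
  assumes "l \<ge> 1" "agree r ((shift ^^ l) y) y" "y \<in> Sig d"
  defines "q \<equiv> \<lambda>i. y (i mod l)"
  shows "(shift ^^ l) q = q" "agree (l + r) q y" "q \<in> Sig d"
proof -
  show "(shift ^^ l) q = q"
    by (simp add: funpow_shift q_def)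
  show "q \<in> Sig d"
    using assms(3) by (simp add: q_def Sig_def)
  show "agree (l + r) q y"
  proof (intro allI impI)
    fix i assume "i < l + r"
    then show "q i = y i"
    proof (induction i rule: less_induct)
      case (less i)
      show ?case
      proof (cases "i < l")
        case False
        then have "q i = q (i - l)"
          by (simp add: q_def le_mod_geq)
        also have "\<dots> = y (i - l)"
          using less False assms(1) by simp
        also have "\<dots> = y i"
          using assms(2) less(2) False by (auto simp: funpow_shift dest!: spec[of _ "i - l"])
        finally show ?thesis .
      qed (simp add: q_def)
    qed
  qed
qed

section \<open>The Hoelder space and shadowing estimates\<close>

locale hoelder_shift =
  fixes d :: nat and lam \<alpha> :: real
  assumes d_ge: "1 \<le> d" and lam_pos: "0 < lam" and lam_less: "lam < 1" and alpha_pos: "0 < \<alpha>"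
begin

text \<open>The contraction ratio for the metric raised to the power \<alpha>: agreement on
  \<open>n\<close> symbols bounds it by \<open>\<theta> ^ n\<close>, so Hoelder estimates along
  orbits become geometric series.\<close>

definition \<theta> :: real where "\<theta> = lam powr \<alpha>"

lemma theta: "0 < \<theta>" "\<theta> < 1"
proof -
  show "0 < \<theta>" using lam_pos by (simp add: \<theta>_def)
  show "\<theta> < 1"
    using powr_less_mono2[OF alpha_pos _ lam_less] lam_pos by (simp add: \<theta>_def)
qed

abbreviation "\<Sigma> \<equiv> Sig d"
abbreviation "N \<equiv> holder_norm d lam \<alpha>"
abbreviation "\<C> \<equiv> Calpha d lam \<alpha>"

lemma Sig_nonempty: "(\<lambda>_. 1) \<in> \<Sigma>"
  using d_ge by (simp add: Sig_def)

lemma lam_powr_pow: "(lam ^ k) powr \<alpha> = \<theta> ^ k"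
  using lam_pos by (simp add: \<theta>_def powr_powr powr_realpow[symmetric] mult.commute)

lemma sdist_le: "agree n x y \<Longrightarrow> sdist lam x y \<le> lam ^ n"
proof (cases "x = y")
  case False
  assume "agree n x y"
  moreover from False have "\<exists>k. x k \<noteq> y k" by auto
  then have "x (LEAST k. x k \<noteq> y k) \<noteq> y (LEAST k. x k \<noteq> y k)" by (rule LeastI_ex)
  ultimately have "n \<le> (LEAST k. x k \<noteq> y k)"
    by (meson not_le)
  then show ?thesis
    using False lam_pos lam_less by (simp add: sdist_def power_decreasing)
qed (use lam_pos in \<open>simp add: sdist_def\<close>)

lemma sdist_gt: "\<not> agree n x y \<Longrightarrow> lam ^ n < sdist lam x y"
proof -
  assume "\<not> agree n x y"
  then obtain i where i: "i < n" "x i \<noteq> y i" by auto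
  then have "(LEAST k. x k \<noteq> y k) < n"
    by (meson Least_le le_less_trans)
  then show ?thesis
    using i lam_pos lam_less by (auto simp: sdist_def power_strict_decreasing)
qed

lemma sdist_powr_le: "agree n x y \<Longrightarrow> sdist lam x y powr \<alpha> \<le> \<theta> ^ n"
  using powr_mono2[OF less_imp_le[OF alpha_pos] _ sdist_le] lam_pos
  by (auto simp: lam_powr_pow[symmetric] sdist_def)

lemma sdist_powr_ge: "\<not> agree n x y \<Longrightarrow> \<theta> ^ n \<le> sdist lam x y powr \<alpha>"
  using powr_mono2[OF less_imp_le[OF alpha_pos] _ less_imp_le[OF sdist_gt]] lam_pos
  by (auto simp: lam_powr_pow[symmetric])

lemma sdist_powr_pos: "x \<noteq> y \<Longrightarrow> 0 < sdist lam x y powr \<alpha>"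
  using lam_pos by (simp add: sdist_def)

lemma Calpha_zero: "A \<in> \<C> \<Longrightarrow> x \<notin> \<Sigma> \<Longrightarrow> A x = 0"
  by (simp add: Calpha_def)

text \<open>Replaces the two suprema in the norm by plain constants; sums and multiples then reduce
  to arithmetic on \<open>M\<close> and \<open>L\<close>, with \<open>CalphaI\<close> for the way
  back.\<close>

lemma CalphaE:
  assumes "A \<in> \<C>"
  obtains M L where "0 \<le> M" "0 \<le> L" "N A = M + L"
    "\<And>x. x \<in> \<Sigma> \<Longrightarrow> \<bar>A x\<bar> \<le> M"
    "\<And>x y. x \<in> \<Sigma> \<Longrightarrow> y \<in> \<Sigma> \<Longrightarrow> \<bar>A x - A y\<bar> \<le> L * sdist lam x y powr \<alpha>"
proof
  let ?M = "SUP x\<in>\<Sigma>. \<bar>A x\<bar>" and ?L = "Sup (insert 0 (holder_quots d lam \<alpha> A))"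
  have bdd: "bdd_above ((\<lambda>x. \<bar>A x\<bar>) ` \<Sigma>)" "bdd_above (insert 0 (holder_quots d lam \<alpha> A))"
    using assms by (auto simp: Calpha_def)
  show M: "\<And>x. x \<in> \<Sigma> \<Longrightarrow> \<bar>A x\<bar> \<le> ?M"
    using bdd(1) by (rule cSUP_upper2) auto
  show "0 \<le> ?M"
    using M[OF Sig_nonempty] by linarith
  show "0 \<le> ?L"
    using bdd(2) by (intro cSup_upper) auto
  show "N A = ?M + ?L"
    by (simp add: holder_norm_def)
  fix x y assume xy: "x \<in> \<Sigma>" "y \<in> \<Sigma>"
  show "\<bar>A x - A y\<bar> \<le> ?L * sdist lam x y powr \<alpha>"
  proof (cases "x = y")
    case False
    have "\<bar>A x - A y\<bar> / sdist lam x y powr \<alpha> \<le> ?L"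
      using xy False by (intro cSup_upper[OF _ bdd(2)]) (auto simp: holder_quots_def)
    then show ?thesis
      using sdist_powr_pos[OF False] by (simp add: divide_simps)
  qed (simp add: sdist_def)
qed

lemma CalphaI:
  assumes zero: "\<And>x. x \<notin> \<Sigma> \<Longrightarrow> A x = 0" and L: "0 \<le> L"
    and M: "\<And>x. x \<in> \<Sigma> \<Longrightarrow> \<bar>A x\<bar> \<le> M"
    and H: "\<And>x y. x \<in> \<Sigma> \<Longrightarrow> y \<in> \<Sigma> \<Longrightarrow> x \<noteq> y \<Longrightarrow> \<bar>A x - A y\<bar> \<le> L * sdist lam x y powr \<alpha>"
  shows "A \<in> \<C>" "N A \<le> M + L"
proof -
  have q: "t \<le> L" if "t \<in> insert 0 (holder_quots d lam \<alpha> A)" for t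
    using that L H sdist_powr_pos by (auto simp: holder_quots_def pos_divide_le_eq)
  show "A \<in> \<C>"
    using zero M q by (auto simp: Calpha_def intro!: bdd_aboveI)
  show "N A \<le> M + L"
    unfolding holder_norm_def using Sig_nonempty M q
    by (intro add_mono cSUP_least cSup_least) auto
qed

lemma norm_nonneg: "A \<in> \<C> \<Longrightarrow> 0 \<le> N A"
  by (erule CalphaE) simp

lemma abs_le_norm: "A \<in> \<C> \<Longrightarrow> \<bar>A x\<bar> \<le> N A"
proof (cases "x \<in> \<Sigma>")
  case False
  assume "A \<in> \<C>"
  then show ?thesis using False Calpha_zero[of A x] norm_nonneg[of A] by simp
qed (erule CalphaE, force)

lemma holder_agree:
  assumes "A \<in> \<C>" "x \<in> \<Sigma>" "y \<in> \<Sigma>" "agree n x y"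
  shows "\<bar>A x - A y\<bar> \<le> N A * \<theta> ^ n"
proof -
  obtain M L where bd: "0 \<le> M" "0 \<le> L" "N A = M + L"
    "\<And>x y. x \<in> \<Sigma> \<Longrightarrow> y \<in> \<Sigma> \<Longrightarrow> \<bar>A x - A y\<bar> \<le> L * sdist lam x y powr \<alpha>"
    using CalphaE[OF assms(1)] by metis
  have "\<bar>A x - A y\<bar> \<le> L * sdist lam x y powr \<alpha>"
    using bd assms by blast
  also have "\<dots> \<le> N A * \<theta> ^ n"
    using bd sdist_powr_le[OF assms(4)] by (intro mult_mono) auto
  finally show ?thesis .
qed

lemma Calpha_add:
  assumes A: "A \<in> \<C>" and B: "B \<in> \<C>"
  shows "(\<lambda>x. A x + B x) \<in> \<C>" "N (\<lambda>x. A x + B x) \<le> N A + N B"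
proof -
  obtain M L where bd: "0 \<le> M" "0 \<le> L" "N A = M + L" "\<And>x. x \<in> \<Sigma> \<Longrightarrow> \<bar>A x\<bar> \<le> M"
    "\<And>x y. x \<in> \<Sigma> \<Longrightarrow> y \<in> \<Sigma> \<Longrightarrow> \<bar>A x - A y\<bar> \<le> L * sdist lam x y powr \<alpha>"
    using CalphaE[OF A] by metis
  obtain M' L' where bd': "0 \<le> M'" "0 \<le> L'" "N B = M' + L'" "\<And>x. x \<in> \<Sigma> \<Longrightarrow> \<bar>B x\<bar> \<le> M'"
    "\<And>x y. x \<in> \<Sigma> \<Longrightarrow> y \<in> \<Sigma> \<Longrightarrow> \<bar>B x - B y\<bar> \<le> L' * sdist lam x y powr \<alpha>"
    using CalphaE[OF B] by metis
  have 1: "\<bar>A x + B x\<bar> \<le> M + M'" if "x \<in> \<Sigma>" for x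
    using bd(4)[OF that] bd'(4)[OF that] by linarith
  have 2: "\<bar>(A x + B x) - (A y + B y)\<bar> \<le> (L + L') * sdist lam x y powr \<alpha>"
    if "x \<in> \<Sigma>" "y \<in> \<Sigma>" for x y
    using bd(5)[OF that] bd'(5)[OF that] by (simp add: algebra_simps)
  show "(\<lambda>x. A x + B x) \<in> \<C>" "N (\<lambda>x. A x + B x) \<le> N A + N B"
    using CalphaI[of "\<lambda>x. A x + B x" "L + L'" "M + M'"] bd(1-3) bd'(1-3) 1 2
      Calpha_zero[OF A] Calpha_zero[OF B]
    by auto
qed

lemma Calpha_scale:
  assumes A: "A \<in> \<C>"
  shows "(\<lambda>x. c * A x) \<in> \<C>" "N (\<lambda>x. c * A x) \<le> \<bar>c\<bar> * N A"
proof -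
  obtain M L where bd: "0 \<le> M" "0 \<le> L" "N A = M + L" "\<And>x. x \<in> \<Sigma> \<Longrightarrow> \<bar>A x\<bar> \<le> M"
    "\<And>x y. x \<in> \<Sigma> \<Longrightarrow> y \<in> \<Sigma> \<Longrightarrow> \<bar>A x - A y\<bar> \<le> L * sdist lam x y powr \<alpha>"
    using CalphaE[OF A] by metis
  have 1: "\<bar>c * A x\<bar> \<le> \<bar>c\<bar> * M" if "x \<in> \<Sigma>" for x
    using bd(4)[OF that] by (simp add: abs_mult mult_left_mono)
  have 2: "\<bar>c * A x - c * A y\<bar> \<le> (\<bar>c\<bar> * L) * sdist lam x y powr \<alpha>"
    if "x \<in> \<Sigma>" "y \<in> \<Sigma>" for x y
    using bd(5)[OF that]
    by (simp add: right_diff_distrib[symmetric] abs_mult mult_left_mono mult.assoc)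
  show "(\<lambda>x. c * A x) \<in> \<C>" "N (\<lambda>x. c * A x) \<le> \<bar>c\<bar> * N A"
    using CalphaI[of "\<lambda>x. c * A x" "\<bar>c\<bar> * L" "\<bar>c\<bar> * M"] bd(1-3) 1 2 Calpha_zero[OF A]
    by (auto simp: distrib_left)
qed

lemma Calpha_diff:
  assumes A: "A \<in> \<C>" and B: "B \<in> \<C>"
  shows "(\<lambda>x. A x - B x) \<in> \<C>" "N (\<lambda>x. A x - B x) \<le> N A + N B"
  using Calpha_add[OF A Calpha_scale(1)[OF B, of "-1"]] Calpha_scale(2)[OF B, of "-1"] by auto

text \<open>Points that differ within the first \<open>n\<close> symbols are at least
  \<open>\<theta> ^ n\<close> apart in the metric to the power \<alpha>, while the values differ by
  at most \<open>2 * M\<close>; the quotient serves as Hoelder constant.\<close>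

lemma Calpha_locally_constant:
  assumes zero: "\<And>x. x \<notin> \<Sigma> \<Longrightarrow> f x = 0" and M: "\<And>x. x \<in> \<Sigma> \<Longrightarrow> \<bar>f x\<bar> \<le> M"
    and loc: "\<And>x y. x \<in> \<Sigma> \<Longrightarrow> y \<in> \<Sigma> \<Longrightarrow> agree n x y \<Longrightarrow> f x = f y"
  shows "f \<in> \<C>" "N f \<le> M * (1 + 2 / \<theta> ^ n)"
proof -
  have M0: "0 \<le> M" using M[OF Sig_nonempty] by linarith
  have H: "\<bar>f x - f y\<bar> \<le> (M * 2 / \<theta> ^ n) * sdist lam x y powr \<alpha>"
    if xy: "x \<in> \<Sigma>" "y \<in> \<Sigma>" for x y
  proof (cases "agree n x y")
    case True
    then show ?thesis using loc[OF xy] M0 theta by simp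
  next
    case False
    have "\<bar>f x - f y\<bar> \<le> 2 * M" using M[OF xy(1)] M[OF xy(2)] by linarith
    also have "\<dots> = (M * 2 / \<theta> ^ n) * \<theta> ^ n" using theta by simp
    also have "\<dots> \<le> (M * 2 / \<theta> ^ n) * sdist lam x y powr \<alpha>"
      using M0 theta sdist_powr_ge[OF False] by (intro mult_left_mono) auto
    finally show ?thesis .
  qed
  show "f \<in> \<C>" "N f \<le> M * (1 + 2 / \<theta> ^ n)"
    using CalphaI[of f "M * 2 / \<theta> ^ n" M] zero M H M0 theta by (auto simp: algebra_simps)
qed

text \<open>The i-th iterates still agree on \<open>n + r - i\<close> symbols, so the errors form a
  geometric series. The bound depends on the surplus \<open>r\<close> but not on the length
  \<open>n\<close>.\<close>

lemma shadowing:
  assumes A: "A \<in> \<C>" and xy: "x \<in> \<Sigma>" "y \<in> \<Sigma>" "agree (n + r) x y"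
  shows "\<bar>bsum A n x - bsum A n y\<bar> \<le> N A / (1 - \<theta>) * \<theta> ^ r"
proof -
  \<comment> \<open>The partial sum of the series is kept so that the induction closes.\<close>
  have "\<bar>bsum A n x - bsum A n y\<bar> \<le> N A * \<theta> ^ r * (1 - \<theta> ^ n) / (1 - \<theta>)"
    using xy
  proof (induction n arbitrary: x y)
    case (Suc n)
    have "\<bar>A x - A y\<bar> \<le> N A * \<theta> ^ (Suc n + r)"
      using Suc.prems by (intro holder_agree[OF A])
    also have "\<dots> \<le> N A * \<theta> ^ (n + r)"
      using theta norm_nonneg[OF A] by (intro mult_left_mono power_decreasing) auto
    finally have 1: "\<bar>A x - A y\<bar> \<le> N A * \<theta> ^ (n + r)" .
    have "\<bar>bsum A n (shift x) - bsum A n (shift y)\<bar> \<le> N A * \<theta> ^ r * (1 - \<theta> ^ n) / (1 - \<theta>)"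
      using Suc.prems Sig_shift[of _ d 1] by (intro Suc.IH) (auto simp: shift_def)
    with 1 have "\<bar>bsum A (Suc n) x - bsum A (Suc n) y\<bar>
        \<le> N A * \<theta> ^ (n + r) + N A * \<theta> ^ r * (1 - \<theta> ^ n) / (1 - \<theta>)"
      by (simp add: bsum_Suc)
    also have "\<dots> = N A * \<theta> ^ r * (1 - \<theta> ^ Suc n) / (1 - \<theta>)"
      using theta by (simp add: field_simps power_add)
    finally show ?case .
  qed simp
  also have "\<dots> \<le> N A * \<theta> ^ r * 1 / (1 - \<theta>)"
    using theta norm_nonneg[OF A] by (intro divide_right_mono mult_left_mono) auto
  finally show ?thesis by simp
qed

lemma shadowing_upper:
  assumes "A \<in> \<C>" "x \<in> \<Sigma>" "y \<in> \<Sigma>" "agree (n + r) x y" "N A / (1 - \<theta>) \<le> C"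
  shows "bsum A n x \<le> bsum A n y + C * \<theta> ^ r"
proof -
  have "bsum A n x \<le> bsum A n y + N A / (1 - \<theta>) * \<theta> ^ r"
    using shadowing[OF assms(1-4)] by linarith
  also have "\<dots> \<le> bsum A n y + C * \<theta> ^ r"
    using assms(5) theta by (intro add_left_mono mult_right_mono) auto
  finally show ?thesis .
qed

end

subsection \<open>Measures on the shift space\<close>

definition cyl :: "nat \<Rightarrow> nat list \<Rightarrow> (nat \<Rightarrow> nat) set" where
  "cyl d w = {x \<in> Sig d. pre (length w) x = w}"

text \<open>Sets decided by finitely many coordinates. They form an algebra generating the Borel
  sets, which makes them the domain for Caratheodory's extension.\<close>

definition clopens :: "nat \<Rightarrow> (nat \<Rightarrow> nat) set set" where
  "clopens d = {S. S \<subseteq> Sig d \<and> (\<exists>n. \<forall>x\<in>S. \<forall>y\<in>Sig d. agree n x y \<longrightarrow> y \<in> S)}"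

abbreviation BS :: "nat \<Rightarrow> (nat \<Rightarrow> nat) measure" where
  "BS d \<equiv> restrict_space borel (Sig d)"

lemma mem_cyl: "x \<in> cyl d w \<longleftrightarrow> x \<in> Sig d \<and> (\<forall>i<length w. x i = w ! i)"
proof -
  have "pre (length w) x = w \<longleftrightarrow> (\<forall>i<length w. x i = w ! i)"
    by (subst list_eq_iff_nth_eq) (simp cong: conj_cong)
  then show ?thesis by (simp add: cyl_def)
qed

lemma cyl_pre: "cyl d (pre n x) = {y \<in> Sig d. agree n x y}"
proof (rule set_eqI)
  fix y
  have "(\<forall>i<n. y i = pre n x ! i) \<longleftrightarrow> agree n x y"
    by (metis add_0 length_upt minus_nat.diff_0 nth_map nth_upt)
  then show "y \<in> cyl d (pre n x) \<longleftrightarrow> y \<in> {y \<in> Sig d. agree n x y}"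
    by (simp add: mem_cyl)
qed

lemma clopensI:
  "S \<subseteq> Sig d \<Longrightarrow> (\<And>x y. x \<in> S \<Longrightarrow> y \<in> Sig d \<Longrightarrow> agree n x y \<Longrightarrow> y \<in> S) \<Longrightarrow> S \<in> clopens d"
  unfolding clopens_def by (intro CollectI conjI exI[of _ n] ballI impI) assumption+

lemma clopensE:
  assumes "S \<in> clopens d"
  obtains n where "S \<subseteq> Sig d" "\<And>x y. x \<in> S \<Longrightarrow> y \<in> Sig d \<Longrightarrow> agree n x y \<Longrightarrow> y \<in> S"
proof -
  have "S \<subseteq> Sig d" "\<exists>n. \<forall>x\<in>S. \<forall>y\<in>Sig d. agree n x y \<longrightarrow> y \<in> S"
    using assms by (simp_all add: clopens_def)
  then show thesis
    using that by metis
qed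

lemma cyl_clopen: "cyl d w \<in> clopens d"
  by (rule clopensI[of _ _ "length w"]) (auto simp: mem_cyl)

lemma finite_words: "finite {w :: nat list. set w \<subseteq> {1..d} \<and> length w = n}"
  by (rule finite_lists_length_eq) simp

lemma pre_words: "x \<in> Sig d \<Longrightarrow> set (pre n x) \<subseteq> {1..d} \<and> length (pre n x) = n"
  by (auto simp: Sig_def)

lemma clopen_decomp:
  assumes "S \<subseteq> Sig d" "\<And>x y. x \<in> S \<Longrightarrow> y \<in> Sig d \<Longrightarrow> agree n x y \<Longrightarrow> y \<in> S"
  shows "S = (\<Union>w\<in>pre n ` S. cyl d w)" "finite (pre n ` S)" "disjoint_family_on (cyl d) (pre n ` S)"
proof -
  show "S = (\<Union>w\<in>pre n ` S. cyl d w)"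
  proof
    show "S \<subseteq> (\<Union>w\<in>pre n ` S. cyl d w)"
    proof
      fix x assume "x \<in> S"
      then show "x \<in> (\<Union>w\<in>pre n ` S. cyl d w)"
        using assms(1) by (intro UN_I[of "pre n x"] imageI) (simp_all add: cyl_def subset_iff)
    qed
    show "(\<Union>w\<in>pre n ` S. cyl d w) \<subseteq> S"
    proof (rule UN_least, elim imageE)
      fix w x assume "x \<in> S" "w = pre n x"
      then show "cyl d w \<subseteq> S"
        using assms(2)[of x] by (simp only: cyl_pre subset_iff mem_Collect_eq) blast
    qed
  qed
  show "finite (pre n ` S)"
  proof (rule finite_subset[OF _ finite_words[of d n]], rule image_subsetI, rule CollectI)
    fix x assume "x \<in> S"
    then show "set (pre n x) \<subseteq> {1..d} \<and> length (pre n x) = n"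
      using assms(1) by (intro pre_words) auto
  qed
  show "disjoint_family_on (cyl d) (pre n ` S)"
    unfolding disjoint_family_on_def
  proof (intro ballI impI)
    fix v w assume "v \<in> pre n ` S" "w \<in> pre n ` S" "v \<noteq> w"
    moreover have "length v = n" "length w = n"
      using calculation by auto
    ultimately show "cyl d v \<inter> cyl d w = {}"
      unfolding cyl_def by auto
  qed
qed

lemma space_BS: "space (BS d) = Sig d"
  by (simp add: space_restrict_space)

lemma cyl_sets: "cyl d w \<in> sets (BS d)"
proof -
  have "(\<lambda>x :: nat \<Rightarrow> nat. x i) -` {c} \<inter> space borel \<in> sets borel" for i c
    by (intro measurable_sets[OF measurable_product_coordinates]) simp
  then have "(\<Inter>i\<in>{..<length w}. {x. x i = w ! i}) \<in> sets borel"
    by (cases "w = []") (auto intro: sets.finite_INT simp: vimage_def lessThan_empty_iff)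
  moreover have "cyl d w = Sig d \<inter> (\<Inter>i\<in>{..<length w}. {x. x i = w ! i})"
    by (auto simp: mem_cyl)
  ultimately show ?thesis
    by (auto simp: sets_restrict_space)
qed

lemma clopens_sets: "S \<in> clopens d \<Longrightarrow> S \<in> sets (BS d)"
proof (erule clopensE)
  fix n assume S: "S \<subseteq> Sig d" "\<And>x y. x \<in> S \<Longrightarrow> y \<in> Sig d \<Longrightarrow> agree n x y \<Longrightarrow> y \<in> S"
  have "(\<Union>w\<in>pre n ` S. cyl d w) \<in> sets (BS d)"
    using clopen_decomp(2)[OF S] cyl_sets by (intro sets.finite_UN) auto
  then show "S \<in> sets (BS d)"
    by (simp only: clopen_decomp(1)[OF S, symmetric])
qed

lemma clopens_Pow: "clopens d \<subseteq> Pow (Sig d)"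
  by (auto simp: clopens_def)

lemma algebra_clopens: "algebra (Sig d) (clopens d)"
  unfolding algebra_iff_Int
proof (intro conjI ballI)
  fix S assume "S \<in> clopens d"
  then obtain n where n: "S \<subseteq> Sig d" "\<And>x y. x \<in> S \<Longrightarrow> y \<in> Sig d \<Longrightarrow> agree n x y \<Longrightarrow> y \<in> S"
    by (rule clopensE) blast
  show "Sig d - S \<in> clopens d"
  proof (rule clopensI)
    fix x y assume "x \<in> Sig d - S" "y \<in> Sig d" "agree n x y"
    then show "y \<in> Sig d - S"
      using n(2)[of y x] by fastforce
  qed simp
  fix T assume "T \<in> clopens d"
  then obtain m where m: "T \<subseteq> Sig d" "\<And>x y. x \<in> T \<Longrightarrow> y \<in> Sig d \<Longrightarrow> agree m x y \<Longrightarrow> y \<in> T"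
    by (rule clopensE) blast
  show "S \<inter> T \<in> clopens d"
  proof (rule clopensI)
    fix x y assume "x \<in> S \<inter> T" "y \<in> Sig d" "agree (max m n) x y"
    then show "y \<in> S \<inter> T"
      using n(2)[of x y] m(2)[of x y] by simp
  qed (use n(1) in blast)
qed (use clopens_Pow in \<open>auto simp: clopens_def\<close>)

lemma sets_BS: "sets (BS d) = sigma_sets (Sig d) (clopens d)"
proof
  show "sigma_sets (Sig d) (clopens d) \<subseteq> sets (BS d)"
    using sets.sigma_sets_subset[of "clopens d" "BS d"] clopens_sets space_BS[of d] by auto
  define M where "M = sigma (Sig d) (clopens d)"
  have M: "space M = Sig d" "sets M = sigma_sets (Sig d) (clopens d)"
    using clopens_Pow by (auto simp: M_def)
  \<comment> \<open>Measurability of the identity into the Borel space of sequences is the missing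
    inclusion, and it can be checked coordinate by coordinate.\<close>
  have "(\<lambda>x. x) \<in> borel_measurable M"
  proof (rule measurable_coordinatewise_then_product)
    fix i
    show "(\<lambda>x. x i) \<in> borel_measurable M"
    proof (rule measurableI)
      fix A
      have "(\<lambda>x. x i) -` A \<inter> space M \<in> clopens d"
        by (rule clopensI[of _ _ "Suc i"]) (simp_all add: M)
      then show "(\<lambda>x. x i) -` A \<inter> space M \<in> sets M"
        by (auto simp: M)
    qed simp
  qed
  then have "B \<inter> Sig d \<in> sets M" if "B \<in> sets borel" for B
    using measurable_sets[OF _ that, of "\<lambda>x. x" M] M by simp
  then show "sets (BS d) \<subseteq> sigma_sets (Sig d) (clopens d)"
    unfolding sets_restrict_space M(2)[symmetric] by (simp only: image_subset_iff Int_commute) blast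
qed

lemma shift_measurable: "shift \<in> measurable (BS d) (BS d)"
proof (rule measurable_sigma_sets[OF sets_BS clopens_Pow])
  show "shift \<in> space (BS d) \<rightarrow> Sig d"
    using Sig_shift[of _ d 1] by (simp add: space_BS)
  fix S assume "S \<in> clopens d"
  then obtain n where n: "S \<subseteq> Sig d" "\<And>x y. x \<in> S \<Longrightarrow> y \<in> Sig d \<Longrightarrow> agree n x y \<Longrightarrow> y \<in> S"
    by (rule clopensE) blast
  have "shift y \<in> S" if "shift x \<in> S" "y \<in> Sig d" "agree (Suc n) x y" for x y
    using n(2)[OF that(1)] Sig_shift[OF that(2), of 1] that(3) by (simp add: shift_def)
  then have "shift -` S \<inter> space (BS d) \<in> clopens d"
    by (intro clopensI[of _ _ "Suc n"]) (auto simp: space_BS)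
  then show "shift -` S \<inter> space (BS d) \<in> sets (BS d)"
    by (rule clopens_sets)
qed

lemma measure_clopen:
  assumes M: "prob_space M" "sets M = sets (BS d)"
    and S: "S \<subseteq> Sig d" "\<And>x y. x \<in> S \<Longrightarrow> y \<in> Sig d \<Longrightarrow> agree n x y \<Longrightarrow> y \<in> S"
  shows "measure M S = (\<Sum>w\<in>pre n ` S. measure M (cyl d w))"
proof -
  interpret prob_space M by fact
  have "measure M S = measure M (\<Union>w\<in>pre n ` S. cyl d w)"
    by (rule arg_cong[OF clopen_decomp(1)[OF S]])
  also have "\<dots> = (\<Sum>w\<in>pre n ` S. measure M (cyl d w))"
    using clopen_decomp(2,3)[OF S] cyl_sets M(2) by (intro finite_measure_finite_Union) auto
  finally show ?thesis .
qed

lemma measure_eq_clopen: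
  assumes M: "prob_space M" "sets M = sets (BS d)" and N: "prob_space N" "sets N = sets (BS d)"
    and eq: "\<And>w. measure M (cyl d w) = measure N (cyl d w)" and S: "S \<in> clopens d"
  shows "measure M S = measure N S"
proof -
  obtain n where n: "S \<subseteq> Sig d" "\<And>x y. x \<in> S \<Longrightarrow> y \<in> Sig d \<Longrightarrow> agree n x y \<Longrightarrow> y \<in> S"
    using S by (rule clopensE) blast
  show ?thesis
    using measure_clopen[OF M n] measure_clopen[OF N n] eq by simp
qed

lemma measure_eqI_cyl:
  assumes M: "prob_space M" "sets M = sets (BS d)" and N: "prob_space N" "sets N = sets (BS d)"
    and eq: "\<And>w. measure M (cyl d w) = measure N (cyl d w)"
  shows "M = N"
proof (rule measure_eqI_generator_eq[where E = "clopens d" and \<Omega> = "Sig d" and A = "\<lambda>_. Sig d"])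
  interpret M: prob_space M by fact
  interpret N: prob_space N by fact
  interpret algebra "Sig d" "clopens d" by (rule algebra_clopens)
  show "Int_stable (clopens d)"
    by (auto simp: Int_stable_def)
  show "emeasure M S = emeasure N S" if "S \<in> clopens d" for S
    using measure_eq_clopen[OF M N eq that] by (simp add: M.emeasure_eq_measure N.emeasure_eq_measure)
  show "range (\<lambda>_. Sig d) \<subseteq> clopens d" by auto
  show "emeasure M (Sig d) \<noteq> \<infinity>" by simp
qed (use M N clopens_Pow sets_BS in auto)

lemma inv_probsD:
  assumes "\<mu> \<in> inv_probs d"
  shows "prob_space \<mu>" "sets \<mu> = sets (BS d)" "space \<mu> = Sig d" "distr \<mu> \<mu> shift = \<mu>"
    "shift \<in> measurable \<mu> \<mu>"
proof -
  show *: "prob_space \<mu>" "sets \<mu> = sets (BS d)"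
    using assms by (auto simp: inv_probs_def)
  then show sp: "space \<mu> = Sig d"
    using sets_eq_imp_space_eq space_BS by metis
  show sm: "shift \<in> measurable \<mu> \<mu>"
    using shift_measurable[of d] measurable_cong_sets[OF *(2) *(2)] by simp
  show "distr \<mu> \<mu> shift = \<mu>"
    using assms sp by (intro measure_eqI) (auto simp: emeasure_distr[OF sm] inv_probs_def)
qed

text \<open>A probability is determined by its cylinder masses, so it equals its image under the
  shift once the two agree on cylinders.\<close>

lemma inv_probsI:
  assumes \<mu>: "prob_space \<mu>" "sets \<mu> = sets (BS d)"
    and inv: "\<And>w. measure \<mu> (shift -` cyl d w \<inter> Sig d) = measure \<mu> (cyl d w)"
  shows "\<mu> \<in> inv_probs d"
proof -
  have sp: "space \<mu> = Sig d"
    using \<mu>(2) sets_eq_imp_space_eq space_BS by metis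
  have sm: "shift \<in> measurable \<mu> \<mu>"
    using shift_measurable[of d] measurable_cong_sets[OF \<mu>(2) \<mu>(2)] by simp
  have "distr \<mu> \<mu> shift = \<mu>"
  proof (rule measure_eqI_cyl[of _ d])
    show "prob_space (distr \<mu> \<mu> shift)"
      by (rule prob_space.prob_space_distr[OF \<mu>(1) sm])
    show "measure (distr \<mu> \<mu> shift) (cyl d w) = measure \<mu> (cyl d w)" for w
      using inv cyl_sets[of d w] \<mu>(2) sp by (simp add: measure_distr[OF sm])
  qed (use \<mu> in auto)
  then have "emeasure \<mu> (shift -` B \<inter> Sig d) = emeasure \<mu> B" if "B \<in> sets \<mu>" for B
    using emeasure_distr[OF sm that] sp by simp
  then show ?thesis
    using \<mu> by (auto simp: inv_probs_def)
qed

lemma integral_shift: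
  fixes f :: "(nat \<Rightarrow> nat) \<Rightarrow> real"
  assumes "\<mu> \<in> inv_probs d" "f \<in> borel_measurable \<mu>"
  shows "integral\<^sup>L \<mu> (\<lambda>x. f ((shift ^^ i) x)) = integral\<^sup>L \<mu> f"
proof (induction i)
  case (Suc i)
  note \<mu> = inv_probsD[OF assms(1)]
  have m: "(\<lambda>x. f ((shift ^^ i) x)) \<in> borel_measurable \<mu>"
    using measurable_compose[OF measurable_compose_n[OF \<mu>(5)] assms(2)] .
  have "integral\<^sup>L \<mu> (\<lambda>x. f ((shift ^^ i) (shift x))) = integral\<^sup>L (distr \<mu> \<mu> shift) (\<lambda>x. f ((shift ^^ i) x))"
    by (rule integral_distr[OF \<mu>(5) m, symmetric])
  then show ?case
    using Suc \<mu>(4) by (simp add: funpow_swap1)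
qed simp

subsection \<open>Compactness of the set of invariant measures\<close>

lemma compact_fun_box:
  fixes K :: "'i \<Rightarrow> 'a::topological_space set"
  assumes "\<And>i. compact (K i)"
  shows "compact {x. \<forall>i. x i \<in> K i}"
proof -
  have "compactin (product_topology (\<lambda>_. euclidean) UNIV) (PiE UNIV K)"
    using assms by (auto simp: compactin_PiE)
  moreover have "PiE UNIV K = {x. \<forall>i. x i \<in> K i}" by auto
  ultimately show ?thesis
    by (simp add: euclidean_product_topology)
qed

lemma tendsto_coordinate:
  fixes X :: "nat \<Rightarrow> 'i \<Rightarrow> 'a::topological_space"
  assumes "X \<longlonglongrightarrow> l"
  shows "(\<lambda>k. X k i) \<longlonglongrightarrow> l i"
  using continuous_on_tendsto_compose[OF continuous_on_product_coordinates assms, of i] by simp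

lemma compact_Sig: "compact (Sig d)"
  using compact_fun_box[of "\<lambda>_. {1..d}"] by (simp add: Sig_def finite_imp_compact)

text \<open>Cantor's intersection theorem: points chosen in the sets accumulate somewhere, and
  convergence of sequences of symbols means eventual agreement on each finite prefix, which decides
  membership.\<close>

lemma clopen_decseq_empty:
  assumes A: "range A \<subseteq> clopens d" "decseq A" and empty: "(\<Inter>i. A i) = {}"
  shows "\<exists>i. A i = {}"
proof (rule ccontr)
  assume "\<nexists>i. A i = {}"
  then have "\<forall>i. \<exists>x. x \<in> A i" by auto
  then obtain x where x: "\<And>i. x i \<in> A i" by metis
  have AS: "A i \<subseteq> Sig d" for i
    using A(1) clopens_Pow[of d] by auto
  then have xS: "\<forall>i. x i \<in> Sig d"
    using x by (meson subsetD)
  obtain l r where l: "l \<in> Sig d" "strict_mono r" "(x \<circ> r) \<longlonglongrightarrow> l"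
    by (rule seq_compactE[OF compact_imp_seq_compact[OF compact_Sig[of d]] xS])
  have "l \<in> A j" for j
  proof -
    have "A j \<in> clopens d" using A(1) by blast
    then obtain n where n: "\<And>x y. x \<in> A j \<Longrightarrow> y \<in> Sig d \<Longrightarrow> agree n x y \<Longrightarrow> y \<in> A j"
      by (rule clopensE) blast
    have "\<forall>\<^sub>F k in sequentially. (x \<circ> r) k i = l i" for i
      using tendsto_coordinate[OF l(3), of i] by (simp add: tendsto_discrete)
    then have "\<forall>\<^sub>F k in sequentially. \<forall>i\<in>{..<n}. (x \<circ> r) k i = l i"
      by (intro eventually_ball_finite) auto
    with eventually_ge_at_top[of j] have "\<forall>\<^sub>F k in sequentially. j \<le> k \<and> agree n (x (r k)) l"
      by eventually_elim simp
    then have "\<exists>k. j \<le> k \<and> agree n (x (r k)) l"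
      by (rule eventually_happens'[OF sequentially_bot])
    then obtain k where k: "j \<le> k" "agree n (x (r k)) l"
      by (elim exE conjE)
    have "A (r k) \<subseteq> A j"
      by (rule decseqD[OF A(2) le_trans[OF k(1) strict_mono_imp_increasing[OF l(2)]]])
    then show ?thesis
      using x[of "r k"] by (intro n[OF _ l(1) k(2)]) (rule subsetD)
  qed
  then show False using empty by blast
qed

text \<open>Finite additivity is enough: by compactness a decreasing sequence of clopens with empty
  intersection is eventually empty, so the continuity at the empty set that Caratheodory asks for is
  automatic.\<close>

lemma prob_extension:
  assumes f: "\<And>S. S \<in> clopens d \<Longrightarrow> 0 \<le> f S" "f {} = 0" "f (Sig d) = (1::real)"
    and add: "\<And>S T. S \<in> clopens d \<Longrightarrow> T \<in> clopens d \<Longrightarrow> S \<inter> T = {} \<Longrightarrow> f (S \<union> T) = f S + f T"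
  obtains M where "prob_space M" "sets M = sets (BS d)" "\<And>S. S \<in> clopens d \<Longrightarrow> measure M S = f S"
proof -
  interpret algebra "Sig d" "clopens d" by (rule algebra_clopens)
  have "\<exists>\<mu> :: _ \<Rightarrow> ennreal. (\<forall>s \<in> clopens d. \<mu> s = ennreal (f s)) \<and>
      measure_space (Sig d) (sigma_sets (Sig d) (clopens d)) \<mu>"
  proof (rule caratheodory_empty_continuous)
    show "positive (clopens d) (\<lambda>s. ennreal (f s))"
      using f by (simp add: positive_def)
    show "additive (clopens d) (\<lambda>s. ennreal (f s))"
      using f add by (simp add: additive_def)
    fix A assume A: "range A \<subseteq> clopens d" "decseq A" "(\<Inter>i::nat. A i) = {}"
    then obtain i where i: "A i = {}"
      using clopen_decseq_empty by blast
    have "\<forall>\<^sub>F k in sequentially. ennreal (f (A k)) = 0"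
      using eventually_ge_at_top[of i]
    proof eventually_elim
      case (elim k)
      then have "A k = {}" using decseqD[OF A(2) elim] i by auto
      then show ?case using f(2) by simp
    qed
    then show "(\<lambda>i. ennreal (f (A i))) \<longlonglongrightarrow> 0"
      by (rule tendsto_eventually)
  qed simp
  then obtain \<mu> :: "_ \<Rightarrow> ennreal" where \<mu>: "\<And>s. s \<in> clopens d \<Longrightarrow> \<mu> s = ennreal (f s)"
    "measure_space (Sig d) (sigma_sets (Sig d) (clopens d)) \<mu>"
    by blast
  define M where "M = measure_of (Sig d) (clopens d) \<mu>"
  have M: "space M = Sig d" "sets M = sets (BS d)"
    using clopens_Pow sets_BS by (auto simp: M_def)
  have em: "emeasure M S = ennreal (f S)" if "S \<in> clopens d" for S
  proof -
    have "emeasure M S = \<mu> S"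
      using \<mu>(2) that clopens_Pow
      by (intro emeasure_measure_of[OF M_def]) (auto simp: measure_space_def M sets_BS)
    then show ?thesis using \<mu>(1) that by simp
  qed
  show thesis
  proof
    show "prob_space M"
      using em[of "Sig d"] f(3) M by (intro prob_spaceI) auto
    show "measure M S = f S" if "S \<in> clopens d" for S
      using em[OF that] f(1)[OF that] by (simp add: measure_def)
  qed (rule M)
qed

text \<open>Weak compactness expressed through cylinder masses. Compactness of the cube indexed by
  all words gives a limit of the masses, and \<open>prob_extension\<close> turns it into a
  measure.\<close>

lemma inv_probs_compact:
  fixes \<mu> :: "nat \<Rightarrow> (nat \<Rightarrow> nat) measure"
  assumes \<mu>: "\<And>k. \<mu> k \<in> inv_probs d"
  obtains s \<nu> where "strict_mono (s :: nat \<Rightarrow> nat)" "\<nu> \<in> inv_probs d"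
    "\<And>w. (\<lambda>k. measure (\<mu> (s k)) (cyl d w)) \<longlonglongrightarrow> measure \<nu> (cyl d w)"
proof -
  define F where "F k w = measure (\<mu> k) (cyl d w)" for k w
  have pr: "prob_space (\<mu> k)" "sets (\<mu> k) = sets (BS d)" "space (\<mu> k) = Sig d" for k
    using inv_probsD[OF \<mu>] by auto
  have Fin: "\<forall>k. F k \<in> {x. \<forall>w. x w \<in> {0..1}}"
    using pr(1) by (auto simp: F_def prob_space.prob_le_1)
  have cpt: "compact {x :: nat list \<Rightarrow> real. \<forall>w. x w \<in> {0..1}}"
    by (rule compact_fun_box) simp
  obtain l s where s: "strict_mono (s :: nat \<Rightarrow> nat)" "(F \<circ> s) \<longlonglongrightarrow> l"
    by (rule seq_compactE[OF compact_imp_seq_compact[OF cpt] Fin])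
  have cyl_lim: "(\<lambda>k. measure (\<mu> (s k)) (cyl d w)) \<longlonglongrightarrow> l w" for w
    using tendsto_coordinate[OF s(2), of w] by (simp add: F_def)
  \<comment> \<open>Each clopen is a finite disjoint union of cylinders, so this \<open>lim\<close>
    is a genuine limit and not a default value.\<close>
  define f where "f S = lim (\<lambda>k. measure (\<mu> (s k)) S)" for S
  have lim: "(\<lambda>k. measure (\<mu> (s k)) S) \<longlonglongrightarrow> f S" if S: "S \<in> clopens d" for S
  proof -
    obtain n where n: "S \<subseteq> Sig d" "\<And>x y. x \<in> S \<Longrightarrow> y \<in> Sig d \<Longrightarrow> agree n x y \<Longrightarrow> y \<in> S"
      using S by (rule clopensE) blast
    have "(\<lambda>k. \<Sum>w\<in>pre n ` S. measure (\<mu> (s k)) (cyl d w)) \<longlonglongrightarrow> (\<Sum>w\<in>pre n ` S. l w)"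
      by (intro tendsto_sum cyl_lim)
    then have "(\<lambda>k. measure (\<mu> (s k)) S) \<longlonglongrightarrow> (\<Sum>w\<in>pre n ` S. l w)"
      using measure_clopen[OF pr(1,2) n] by simp
    then show ?thesis by (simp add: f_def limI)
  qed
  interpret algebra "Sig d" "clopens d" by (rule algebra_clopens)
  obtain \<nu> where \<nu>: "prob_space \<nu>" "sets \<nu> = sets (BS d)" "\<And>S. S \<in> clopens d \<Longrightarrow> measure \<nu> S = f S"
  proof (rule prob_extension[of d f])
    show "0 \<le> f S" if "S \<in> clopens d" for S
      by (rule LIMSEQ_le_const[OF lim[OF that]]) simp
    show "f {} = 0"
      using LIMSEQ_unique[OF lim[of "{}"]] by simp
    have "measure (\<mu> (s k)) (Sig d) = 1" for k
      using prob_space.prob_space[OF pr(1)] pr(3) by metis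
    then show "f (Sig d) = 1"
      using LIMSEQ_unique[OF lim[of "Sig d"]] by simp
    fix S T assume ST: "S \<in> clopens d" "T \<in> clopens d" "S \<inter> T = {}"
    have "measure (\<mu> k) (S \<union> T) = measure (\<mu> k) S + measure (\<mu> k) T" for k
      using ST clopens_sets pr by (intro finite_measure.finite_measure_Union)
        (auto simp: prob_space.finite_measure)
    then have "(\<lambda>k. measure (\<mu> (s k)) (S \<union> T)) \<longlonglongrightarrow> f S + f T"
      using tendsto_add[OF lim[OF ST(1)] lim[OF ST(2)]] by simp
    then show "f (S \<union> T) = f S + f T"
      using LIMSEQ_unique[OF lim[OF Un[OF ST(1,2)]]] by blast
  qed blast
  have "\<nu> \<in> inv_probs d"
  proof (rule inv_probsI[OF \<nu>(1,2)])
    fix w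
    have "shift -` cyl d w \<inter> Sig d \<in> clopens d"
    proof (rule clopensI[of _ _ "Suc (length w)"])
      fix x y assume "x \<in> shift -` cyl d w \<inter> Sig d" "y \<in> Sig d" "agree (Suc (length w)) x y"
      then show "y \<in> shift -` cyl d w \<inter> Sig d"
        using Sig_shift[of y d 1] by (auto simp: mem_cyl shift_def)
    qed simp
    moreover have "measure (\<mu> k) (shift -` cyl d w \<inter> Sig d) = measure (\<mu> k) (cyl d w)" for k
      using \<mu>[of k] cyl_sets[of d w] by (auto simp: inv_probs_def measure_def)
    ultimately show "measure \<nu> (shift -` cyl d w \<inter> Sig d) = measure \<nu> (cyl d w)"
      using LIMSEQ_unique[OF lim[of "shift -` cyl d w \<inter> Sig d"]] lim[OF cyl_clopen[of d w]]
        \<nu>(3) cyl_clopen[of d w] by simp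
  qed
  moreover have "(\<lambda>k. measure (\<mu> (s k)) (cyl d w)) \<longlonglongrightarrow> measure \<nu> (cyl d w)" for w
    using lim[OF cyl_clopen] \<nu>(3)[OF cyl_clopen] by simp
  ultimately show thesis
    using that s(1) by blast
qed

context hoelder_shift
begin

abbreviation "\<I> \<equiv> inv_probs d"
abbreviation "words n \<equiv> {w. set w \<subseteq> {1..d} \<and> length w = n}"

subsection \<open>Integrals of Hoelder functions\<close>

text \<open>The filling symbol 1 belongs to the alphabet by \<open>d_ge\<close>, so a word over the
  alphabet extends to a point of the shift space.\<close>

definition ext :: "nat list \<Rightarrow> nat \<Rightarrow> nat" where
  "ext w = (\<lambda>i. if i < length w then w ! i else 1)"

text \<open>Samples \<open>A\<close> at one point of each cylinder of length \<open>n\<close>. The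
  error is at most \<open>N A * \<theta> ^ n\<close>, which reduces integrals to finite combinations
  of cylinder masses.\<close>

definition approx :: "((nat \<Rightarrow> nat) \<Rightarrow> real) \<Rightarrow> nat \<Rightarrow> (nat \<Rightarrow> nat) \<Rightarrow> real" where
  "approx A n x = (\<Sum>w\<in>words n. A (ext w) * indicator (cyl d w) x)"

lemma ext_pre: "x \<in> \<Sigma> \<Longrightarrow> ext (pre n x) \<in> \<Sigma>" "agree n x (ext (pre n x))"
  using d_ge by (simp_all add: ext_def Sig_def)

lemma approx_eq: "x \<in> \<Sigma> \<Longrightarrow> approx A n x = A (ext (pre n x))"
proof -
  assume x: "x \<in> \<Sigma>"
  have "approx A n x = (\<Sum>w\<in>words n. if w = pre n x then A (ext w) else 0)"
    unfolding approx_def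
  proof (rule sum.cong[OF refl])
    fix w assume "w \<in> words n"
    then have "x \<in> cyl d w \<longleftrightarrow> pre n x = w"
      using x by (simp add: cyl_def)
    then show "A (ext w) * indicator (cyl d w) x = (if w = pre n x then A (ext w) else 0)"
      by (auto simp: indicator_def)
  qed
  also have "\<dots> = A (ext (pre n x))"
    using pre_words[OF x, of n] finite_words[of d n] by (subst sum.delta) auto
  finally show ?thesis .
qed

lemma approx_close: "A \<in> \<C> \<Longrightarrow> x \<in> \<Sigma> \<Longrightarrow> \<bar>A x - approx A n x\<bar> \<le> N A * \<theta> ^ n"
  unfolding approx_eq by (rule holder_agree[OF _ _ ext_pre])

lemma approx_measurable: "approx A n \<in> borel_measurable (BS d)"
  unfolding approx_def using cyl_sets by measurable

lemma theta_pow_lim: "(\<lambda>n. c * \<theta> ^ n) \<longlonglongrightarrow> 0"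
  using tendsto_mult_right_zero[OF LIMSEQ_power_zero[of \<theta>]] theta by simp

lemma theta_pow_small:
  assumes "0 < e"
  obtains n where "m \<le> n" "c * \<theta> ^ n \<le> e"
proof -
  have "\<forall>\<^sub>F n in sequentially. c * \<theta> ^ n < e"
    using order_tendstoD(2)[OF theta_pow_lim assms] .
  then have "\<forall>\<^sub>F n in sequentially. m \<le> n \<and> c * \<theta> ^ n < e"
    using eventually_conj[OF eventually_ge_at_top[of m]] by blast
  then have "\<exists>n. m \<le> n \<and> c * \<theta> ^ n < e"
    by (rule eventually_happens'[OF sequentially_bot])
  then show thesis
    using that by (meson less_imp_le)
qed

lemma Calpha_measurable: "A \<in> \<C> \<Longrightarrow> A \<in> borel_measurable (BS d)"
proof (rule borel_measurable_LIMSEQ_real)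
  fix x assume A: "A \<in> \<C>" and "x \<in> space (BS d)"
  then have "x \<in> \<Sigma>" by (simp add: space_BS)
  then have "\<forall>n. norm (approx A n x - A x) \<le> N A * \<theta> ^ n"
    using approx_close[OF A, of x] by (simp add: abs_minus_commute)
  then have "(\<lambda>n. approx A n x - A x) \<longlonglongrightarrow> 0"
    by (intro Lim_null_comparison[OF _ theta_pow_lim[of "N A"]] always_eventually)
  then show "(\<lambda>n. approx A n x) \<longlonglongrightarrow> A x"
    by (rule LIM_zero_cancel)
qed (rule approx_measurable)

lemma bounded_integrable:
  assumes "\<mu> \<in> \<I>" "f \<in> borel_measurable (BS d)" "\<And>x. x \<in> \<Sigma> \<Longrightarrow> \<bar>f x\<bar> \<le> (M::real)"
  shows "integrable \<mu> f"
proof -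
  interpret prob_space \<mu> by (rule inv_probsD[OF assms(1)])
  have "f \<in> borel_measurable \<mu>"
    using assms(2) measurable_cong_sets[OF inv_probsD(2)[OF assms(1)] refl] by blast
  then show ?thesis
    using assms(3) inv_probsD(3)[OF assms(1)] by (intro integrable_const_bound[of _ M]) auto
qed

lemma Calpha_integrable: "\<mu> \<in> \<I> \<Longrightarrow> A \<in> \<C> \<Longrightarrow> integrable \<mu> A"
  by (rule bounded_integrable[OF _ Calpha_measurable abs_le_norm])

lemma integral_bounds:
  assumes "\<mu> \<in> \<I>" "A \<in> \<C>" "\<And>x. x \<in> \<Sigma> \<Longrightarrow> \<bar>A x\<bar> \<le> c"
  shows "\<bar>integral\<^sup>L \<mu> A\<bar> \<le> c"
proof -
  interpret prob_space \<mu> by (rule inv_probsD[OF assms(1)])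
  have "AE x in \<mu>. A x \<le> c" "AE x in \<mu>. -c \<le> A x"
    using assms(3) inv_probsD(3)[OF assms(1)] by (fastforce intro!: AE_I2)+
  then show ?thesis
    using integral_le_const[OF Calpha_integrable[OF assms(1,2)]]
      integral_ge_const[OF Calpha_integrable[OF assms(1,2)]] by fastforce
qed

lemma cyl_integrable: "\<mu> \<in> \<I> \<Longrightarrow> integrable \<mu> (indicator (cyl d w) :: _ \<Rightarrow> real)"
  by (rule bounded_integrable[OF _ borel_measurable_indicator[OF cyl_sets], of _ _ 1]) auto

lemma integral_cyl: "\<mu> \<in> \<I> \<Longrightarrow> integral\<^sup>L \<mu> (indicator (cyl d w)) = measure \<mu> (cyl d w)"
  using inv_probsD(3)[of \<mu> d] by (simp add: cyl_def Int_absorb2)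

lemma integral_close:
  assumes "A \<in> \<C>" "\<mu> \<in> \<I>"
  shows "\<bar>integral\<^sup>L \<mu> A - (\<Sum>w\<in>words n. A (ext w) * measure \<mu> (cyl d w))\<bar> \<le> N A * \<theta> ^ n"
proof -
  interpret prob_space \<mu> by (rule inv_probsD[OF assms(2)])
  have int: "integrable \<mu> (approx A n)"
    unfolding approx_def by (intro Bochner_Integration.integrable_sum integrable_mult_right cyl_integrable assms)
  have "integral\<^sup>L \<mu> (approx A n) = (\<Sum>w\<in>words n. A (ext w) * measure \<mu> (cyl d w))"
    unfolding approx_def using cyl_integrable[OF assms(2)] integral_cyl[OF assms(2)]
    by (simp add: Bochner_Integration.integral_sum)
  then have "\<bar>integral\<^sup>L \<mu> A - (\<Sum>w\<in>words n. A (ext w) * measure \<mu> (cyl d w))\<bar>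
      = \<bar>integral\<^sup>L \<mu> (\<lambda>x. A x - approx A n x)\<bar>"
    using int Calpha_integrable[OF assms(2,1)] by simp
  also have "\<dots> \<le> integral\<^sup>L \<mu> (\<lambda>x. \<bar>A x - approx A n x\<bar>)"
    by (rule integral_abs_bound)
  also have "\<dots> \<le> N A * \<theta> ^ n"
    using int Calpha_integrable[OF assms(2,1)] approx_close[OF assms(1)] inv_probsD(3)[OF assms(2)]
    by (intro integral_le_const) auto
  finally show ?thesis .
qed

lemma integral_tendsto:
  assumes A: "A \<in> \<C>" and \<mu>: "\<And>k. \<mu> k \<in> \<I>" "\<nu> \<in> \<I>"
    and lim: "\<And>w. (\<lambda>k. measure (\<mu> k) (cyl d w)) \<longlonglongrightarrow> measure \<nu> (cyl d w)"
  shows "(\<lambda>k. integral\<^sup>L (\<mu> k) A) \<longlonglongrightarrow> integral\<^sup>L \<nu> A"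
proof (rule LIMSEQ_I)
  fix e :: real assume "0 < e"
  then obtain n where n: "N A * \<theta> ^ n \<le> e / 4"
    using theta_pow_small[of "e / 4" 0 "N A"] by auto
  define J where "J \<mu> = (\<Sum>w\<in>words n. A (ext w) * measure \<mu> (cyl d w))" for \<mu>
  have "(\<lambda>k. J (\<mu> k)) \<longlonglongrightarrow> J \<nu>"
    unfolding J_def by (intro tendsto_sum tendsto_mult tendsto_const lim)
  then obtain k0 where k0: "\<And>k. k0 \<le> k \<Longrightarrow> norm (J (\<mu> k) - J \<nu>) < e / 4"
    using LIMSEQ_D[of _ _ "e / 4"] \<open>0 < e\<close> by (metis zero_less_divide_iff zero_less_numeral)
  have "norm (integral\<^sup>L (\<mu> k) A - integral\<^sup>L \<nu> A) < e" if "k0 \<le> k" for k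
    using k0[OF that] integral_close[OF A \<mu>(1)[of k], of n, folded J_def]
      integral_close[OF A \<mu>(2), of n, folded J_def] n \<open>0 < e\<close>
    unfolding real_norm_def by linarith
  then show "\<exists>k0. \<forall>k\<ge>k0. norm (integral\<^sup>L (\<mu> k) A - integral\<^sup>L \<nu> A) < e"
    by blast
qed

subsection \<open>Periodic orbit measures\<close>

text \<open>For a point of period \<open>n\<close>, this is its periodic orbit measure;
  \<open>n\<close> may be any multiple of the least period, since repetitions are counted with
  multiplicity.\<close>

definition orbit_measure :: "nat \<Rightarrow> (nat \<Rightarrow> nat) \<Rightarrow> (nat \<Rightarrow> nat) measure" where
  "orbit_measure n p = distr (measure_pmf (pmf_of_set {..<n})) (BS d) (\<lambda>i. (shift ^^ i) p)"

lemma orbit_measure_integral: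
  assumes "p \<in> \<Sigma>" "1 \<le> n" "f \<in> borel_measurable (BS d)"
  shows "integral\<^sup>L (orbit_measure n p) f = bsum f n p / n"
proof -
  have "{..<n} \<noteq> {}" using assms(2) by (auto simp: lessThan_empty_iff)
  moreover have "(\<lambda>i. (shift ^^ i) p) \<in> measurable (measure_pmf (pmf_of_set {..<n})) (BS d)"
    using Sig_shift[OF assms(1)] by (simp add: space_BS)
  ultimately show ?thesis
    using assms(3) by (simp add: orbit_measure_def integral_distr integral_pmf_of_set bsum_def)
qed

lemma bsum_periodic_shift:
  assumes "(shift ^^ n) p = p"
  shows "bsum f n (shift p) = bsum f n p"
proof -
  have "f p + bsum f n (shift p) = bsum f (n + 1) p"
    by (simp add: bsum_Suc)
  also have "\<dots> = bsum f n p + f p"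
    using assms unfolding bsum_add by (simp add: bsum_def)
  finally show ?thesis by simp
qed

lemma orbit_measure_inv:
  assumes p: "p \<in> \<Sigma>" "1 \<le> n" "(shift ^^ n) p = p"
  shows "orbit_measure n p \<in> \<I>"
    "measure (orbit_measure n p) (cyl d w) = bsum (indicator (cyl d w)) n p / n"
proof -
  let ?M = "orbit_measure n p"
  have meas: "(\<lambda>i. (shift ^^ i) p) \<in> measurable (measure_pmf (pmf_of_set {..<n})) (BS d)"
    using Sig_shift[OF p(1)] by (simp add: space_BS)
  have pr: "prob_space ?M"
    unfolding orbit_measure_def by (rule prob_space.prob_space_distr[OF _ meas]) (rule prob_space_measure_pmf)
  have sets: "sets ?M = sets (BS d)" "space ?M = \<Sigma>"
    by (simp_all add: orbit_measure_def space_BS)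
  have m: "measure ?M S = bsum (indicator S) n p / n" if "S \<in> sets (BS d)" for S
  proof -
    have "measure ?M S = integral\<^sup>L ?M (indicator S)"
      using that sets sets.sets_into_space[OF that] by (simp add: Int_absorb2 space_BS)
    then show ?thesis
      using orbit_measure_integral[OF p(1,2), of "indicator S"] that by simp
  qed
  show "measure ?M (cyl d w) = bsum (indicator (cyl d w)) n p / n"
    by (rule m[OF cyl_sets])
  show "?M \<in> \<I>"
  proof (rule inv_probsI[OF pr sets(1)])
    fix w
    have S: "shift -` cyl d w \<inter> \<Sigma> \<in> sets (BS d)"
      using measurable_sets[OF shift_measurable cyl_sets] by (simp add: space_BS)
    have "bsum (indicator (shift -` cyl d w \<inter> \<Sigma>)) n p = bsum (indicator (cyl d w)) n (shift p)"
      unfolding bsum_def using Sig_shift[OF p(1)]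
      by (intro sum.cong refl) (simp add: indicator_def funpow_swap1)
    then have "measure ?M (shift -` cyl d w \<inter> \<Sigma>) = bsum (indicator (cyl d w)) n p / n"
      using m[OF S] by (simp add: bsum_periodic_shift[OF p(3)])
    then show "measure ?M (shift -` cyl d w \<inter> \<Sigma>) = measure ?M (cyl d w)"
      by (simp add: m[OF cyl_sets])
  qed
qed

lemma inv_probs_nonempty: "\<I> \<noteq> {}"
proof -
  have "(shift ^^ 1) (\<lambda>_. 1) = (\<lambda>_. 1)"
    unfolding funpow_shift ..
  then show ?thesis
    using orbit_measure_inv(1)[OF Sig_nonempty, of 1] by auto
qed

lemma integral_le_mA: "A \<in> \<C> \<Longrightarrow> \<mu> \<in> \<I> \<Longrightarrow> integral\<^sup>L \<mu> A \<le> mA d A"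
proof -
  assume A: "A \<in> \<C>" "\<mu> \<in> \<I>"
  have "integral\<^sup>L \<mu> A \<le> N A" if "\<mu> \<in> \<I>" for \<mu>
    using integral_bounds[OF that A(1) abs_le_norm[OF A(1)]] by linarith
  then have "bdd_above {integral\<^sup>L \<mu> A |\<mu>. \<mu> \<in> \<I>}"
    by (intro bdd_aboveI[of _ "N A"]) blast
  then show ?thesis
    unfolding mA_def using A(2) by (intro cSup_upper) auto
qed

text \<open>The functional is continuous for convergence of cylinder masses, so a maximizing
  sequence has a maximizing limit. The case \<open>W = {}\<close> yields maximizing measures, the
  general case the convex perturbation.\<close>

lemma exists_maximizer:
  fixes c :: real
  assumes A: "A \<in> \<C>" and W: "finite W"
  defines "G \<equiv> \<lambda>\<mu>. integral\<^sup>L \<mu> A + c * (\<Sum>w\<in>W. (measure \<mu> (cyl d w))\<^sup>2)"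
  obtains \<mu> where "\<mu> \<in> \<I>" "\<And>\<nu>. \<nu> \<in> \<I> \<Longrightarrow> G \<nu> \<le> G \<mu>"
proof -
  have "G \<mu> \<le> N A + \<bar>c\<bar> * card W" if \<mu>: "\<mu> \<in> \<I>" for \<mu>
  proof -
    have "(measure \<mu> (cyl d w))\<^sup>2 \<le> 1" for w
      using prob_space.prob_le_1[OF inv_probsD(1)[OF \<mu>]] by (simp add: power_le_one)
    then have "(\<Sum>w\<in>W. (measure \<mu> (cyl d w))\<^sup>2) \<le> card W"
      using sum_mono[of W "\<lambda>w. (measure \<mu> (cyl d w))\<^sup>2" "\<lambda>_. 1"] by simp
    moreover have "0 \<le> (\<Sum>w\<in>W. (measure \<mu> (cyl d w))\<^sup>2)"
      by (intro sum_nonneg) simp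
    ultimately have "c * (\<Sum>w\<in>W. (measure \<mu> (cyl d w))\<^sup>2) \<le> \<bar>c\<bar> * card W"
      by (intro mult_mono) auto
    then show ?thesis
      using integral_bounds[OF \<mu> A abs_le_norm[OF A]] by (simp add: G_def)
  qed
  then have bdd: "bdd_above (G ` \<I>)" by (intro bdd_aboveI2)
  define S where "S = Sup (G ` \<I>)"
  have "\<exists>\<mu>\<in>\<I>. S - 1 / Suc k < G \<mu>" for k
    using less_cSup_iff[OF _ bdd, of "S - 1 / Suc k"] inv_probs_nonempty by (simp add: S_def)
  then obtain \<mu> where \<mu>: "\<And>k. \<mu> k \<in> \<I>" "\<And>k. S - 1 / Suc k < G (\<mu> k)"
    by metis
  obtain s \<nu> where s: "strict_mono (s :: nat \<Rightarrow> nat)" "\<nu> \<in> \<I>"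
    "\<And>w. (\<lambda>k. measure (\<mu> (s k)) (cyl d w)) \<longlonglongrightarrow> measure \<nu> (cyl d w)"
    by (rule inv_probs_compact[of \<mu> d, OF \<mu>(1)]) blast
  have "(\<lambda>k. G (\<mu> (s k))) \<longlonglongrightarrow> G \<nu>"
    unfolding G_def by (intro tendsto_add integral_tendsto tendsto_mult tendsto_sum tendsto_power
      tendsto_const s A \<mu>)
  moreover have "(\<lambda>k. S - 1 / Suc (s k)) \<longlonglongrightarrow> S - 0"
    using LIMSEQ_subseq_LIMSEQ[OF LIMSEQ_Suc[OF lim_1_over_n] s(1)]
    by (intro tendsto_diff tendsto_const) (simp add: o_def)
  ultimately have "S \<le> G \<nu>"
    using \<mu>(2) by (intro tendsto_le[OF sequentially_bot]) (auto intro: always_eventually less_imp_le)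
  then have "G \<mu> \<le> G \<nu>" if "\<mu> \<in> \<I>" for \<mu>
    using cSup_upper[OF imageI[OF that] bdd] by (simp add: S_def)
  then show thesis
    using that[OF s(2)] by blast
qed

lemma maxmeas_nonempty:
  assumes A: "A \<in> \<C>"
  obtains \<mu> where "\<mu> \<in> maxmeas d A"
proof -
  obtain \<mu> where \<mu>: "\<mu> \<in> \<I>" "\<And>\<nu>. \<nu> \<in> \<I> \<Longrightarrow> integral\<^sup>L \<nu> A \<le> integral\<^sup>L \<mu> A"
    using exists_maximizer[OF A, of "{}"] by auto
  then have "mA d A \<le> integral\<^sup>L \<mu> A"
    unfolding mA_def by (intro cSup_least) auto
  then show thesis
    using that[of \<mu>] integral_le_mA[OF A \<mu>(1)] \<mu>(1) by (simp add: maxmeas_def)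
qed

subsection \<open>Birkhoff sums of the normalised potential\<close>

definition dev :: "((nat \<Rightarrow> nat) \<Rightarrow> real) \<Rightarrow> nat \<Rightarrow> (nat \<Rightarrow> nat) \<Rightarrow> real" where
  "dev A = bsum (\<lambda>x. A x - mA d A)"

lemma dev_eq: "dev A n x = bsum A n x - n * mA d A"
  by (simp add: dev_def bsum_def sum_subtractf)

text \<open>The measure on the periodic orbit competes in the supremum that defines
  \<open>mA d A\<close>.\<close>

lemma dev_periodic:
  assumes A: "A \<in> \<C>" and p: "p \<in> \<Sigma>" "(shift ^^ n) p = p"
  shows "dev A n p \<le> 0"
proof (cases "n = 0")
  case False
  then have n: "1 \<le> n" by simp
  have "bsum A n p / n \<le> mA d A"
    using integral_le_mA[OF A orbit_measure_inv(1)[OF p(1) n p(2)]]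
      orbit_measure_integral[OF p(1) n Calpha_measurable[OF A]] by simp
  then show ?thesis
    using n by (simp add: dev_eq field_simps)
qed (simp add: dev_eq)

lemma dev_shadowing:
  assumes "A \<in> \<C>" "x \<in> \<Sigma>" "y \<in> \<Sigma>" "agree (n + r) x y" "N A / (1 - \<theta>) \<le> C"
  shows "dev A n x \<le> dev A n y + C * \<theta> ^ r"
  using shadowing_upper[OF assms] by (simp add: dev_eq)

text \<open>Closing the near return produces a periodic orbit, which cannot gain, and shadowing
  compares the two. For \<open>r = 0\<close> every orbit segment qualifies, so all normalised sums
  are bounded by \<open>C\<close>.\<close>

lemma dev_closing:
  assumes A: "A \<in> \<C>" and y: "y \<in> \<Sigma>" "agree r ((shift ^^ l) y) y" and C: "N A / (1 - \<theta>) \<le> C"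
  shows "dev A l y \<le> C * \<theta> ^ r"
proof (cases "l = 0")
  case True
  have "0 \<le> C"
    using C theta norm_nonneg[OF A] by (meson divide_nonneg_pos diff_gt_0_iff_gt order_trans)
  then show ?thesis
    using True theta by (simp add: dev_eq)
next
  case False
  then have l: "1 \<le> l" by simp
  note q = closing[OF l y(2,1)]
  have "agree (l + r) y (\<lambda>i. y (i mod l))"
    using q(2) by simp
  from dev_shadowing[OF A y(1) q(3) this C] show ?thesis
    using dev_periodic[OF A q(3,1)] by linarith
qed

end

subsection \<open>The Aubry set\<close>

text \<open>By monotonicity the right limit at 0 exists and is the infimum, so \<open>Lim\<close> in
  \<open>mane\<close> denotes a genuine limit.\<close>

lemma Lim_at_right_mono:
  fixes F :: "real \<Rightarrow> ereal"
  assumes mono: "\<And>a b. 0 < a \<Longrightarrow> a \<le> b \<Longrightarrow> F a \<le> F b"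
  shows "Lim (at_right 0) F = (INF e\<in>{0<..}. F e)"
proof (rule tendsto_Lim[OF trivial_limit_at_right_real], rule order_tendstoI)
  fix l assume l: "l < (INF e\<in>{0<..}. F e)"
  have "l < F e" if "0 < e" for e
    using INF_lower[of e "{0<..}" F] that l by (simp add: less_le_trans)
  then show "\<forall>\<^sub>F e in at_right 0. l < F e"
    using eventually_at_right_less[of "0 :: real"] by (rule eventually_mono[rotated])
next
  fix a assume "(INF e\<in>{0<..}. F e) < a"
  then obtain e0 where e0: "0 < e0" "F e0 < a"
    unfolding INF_less_iff by auto
  have "F e < a" if "0 < e" "e < e0" for e
    using mono[of e e0] that e0 by (simp add: le_less_trans)
  then show "\<forall>\<^sub>F e in at_right 0. F e < a"
    unfolding eventually_at_right_field using e0(1) by blast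
qed

context hoelder_shift
begin

lemma mane_eq:
  "mane d lam A x y = (INF e\<in>{0<..}. Sup {ereal (dev A n z) | n z.
     n \<ge> 1 \<and> z \<in> \<Sigma> \<and> (shift ^^ n) z = y \<and> sdist lam z x < e})"
  unfolding mane_def dev_def bsum_def
proof (rule Lim_at_right_mono, rule Sup_subset_mono)
  fix a b :: real assume "a \<le> b"
  then show "{ereal (\<Sum>i<n. A ((shift ^^ i) z) - mA d A) | n z.
      n \<ge> 1 \<and> z \<in> \<Sigma> \<and> (shift ^^ n) z = y \<and> sdist lam z x < a} \<subseteq>
    {ereal (\<Sum>i<n. A ((shift ^^ i) z) - mA d A) | n z.
      n \<ge> 1 \<and> z \<in> \<Sigma> \<and> (shift ^^ n) z = y \<and> sdist lam z x < b}"
    by (intro Collect_mono impI) (elim exE conjE, intro exI conjI, auto)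
qed

lemma lam_pow_small:
  assumes "0 < e"
  obtains P where "lam ^ P < e"
  using real_arch_pow_inv[OF assms lam_less] by blast

text \<open>The potential at \<open>(x, x)\<close> is never positive, because a gain along a near
  return would survive closing. It therefore vanishes exactly when, at every scale, there are near
  returns to \<open>x\<close> with arbitrarily small loss.\<close>

lemma aubry_iff:
  assumes A: "A \<in> \<C>"
  shows "x \<in> aubry d lam A \<longleftrightarrow> x \<in> \<Sigma> \<and> (\<forall>P. \<forall>\<eta>>0. \<exists>n\<ge>1. \<exists>z\<in>\<Sigma>.
    (shift ^^ n) z = x \<and> agree P z x \<and> - \<eta> < dev A n z)"
proof (cases "x \<in> \<Sigma>")
  case x: True
  define L where "L e = {ereal (dev A n z) | n z.
     n \<ge> 1 \<and> z \<in> \<Sigma> \<and> (shift ^^ n) z = x \<and> sdist lam z x < e}" for e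
  have mane: "mane d lam A x x = (INF e\<in>{0<..}. Sup (L e))"
    by (simp add: mane_eq L_def)
  have agreeD: "agree P z x" if "sdist lam z x < lam ^ P" for z P
    using sdist_gt[of P z x] that by (meson less_asym)
  have upper: "(INF e\<in>{0<..}. Sup (L e)) \<le> 0"
  proof (rule ccontr)
    assume "\<not> ?thesis"
    then obtain r where r: "0 < ereal r" "ereal r < (INF e\<in>{0<..}. Sup (L e))"
      using ereal_dense2[of 0] by (auto simp: not_le)
    then have "0 < r" by simp
    then obtain P where P: "N A / (1 - \<theta>) * \<theta> ^ P \<le> r"
      using theta_pow_small[of r 0 "N A / (1 - \<theta>)"] by auto
    have "dev A n z \<le> r" if z: "z \<in> \<Sigma>" "(shift ^^ n) z = x" "sdist lam z x < lam ^ P" for n z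
    proof -
      have "agree P ((shift ^^ n) z) z"
        using agreeD[OF z(3)] z(2) by simp
      from dev_closing[OF A z(1) this order_refl] show ?thesis
        using P by linarith
    qed
    then have "Sup (L (lam ^ P)) \<le> ereal r"
      by (intro Sup_least) (auto simp: L_def)
    moreover have "(INF e\<in>{0<..}. Sup (L e)) \<le> Sup (L (lam ^ P))"
      using lam_pos by (intro INF_lower) simp
    ultimately show False
      using r(2) by (meson leD le_less_trans)
  qed
  have "mane d lam A x x = 0 \<longleftrightarrow> (\<forall>e>0. 0 \<le> Sup (L e))"
    unfolding mane using upper by (simp add: eq_iff le_INF_iff)
  also have "\<dots> \<longleftrightarrow> (\<forall>P. \<forall>\<eta>>0. \<exists>n\<ge>1. \<exists>z\<in>\<Sigma>. (shift ^^ n) z = x \<and> agree P z x \<and> - \<eta> < dev A n z)"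
  proof (intro iffI allI impI)
    fix P and \<eta> :: real assume "\<forall>e>0. 0 \<le> Sup (L e)" and \<eta>: "0 < \<eta>"
    then have "0 \<le> Sup (L (lam ^ P))"
      using lam_pos by simp
    moreover have "ereal (- \<eta>) < 0"
      using \<eta> by simp
    ultimately have "ereal (- \<eta>) < Sup (L (lam ^ P))"
      by (rule less_le_trans[rotated])
    then obtain t where "t \<in> L (lam ^ P)" "ereal (- \<eta>) < t"
      unfolding less_Sup_iff by blast
    then show "\<exists>n\<ge>1. \<exists>z\<in>\<Sigma>. (shift ^^ n) z = x \<and> agree P z x \<and> - \<eta> < dev A n z"
      using agreeD unfolding L_def by fastforce
  next
    fix e :: real
    assume H: "\<forall>P. \<forall>\<eta>>0. \<exists>n\<ge>1. \<exists>z\<in>\<Sigma>. (shift ^^ n) z = x \<and> agree P z x \<and> - \<eta> < dev A n z"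
      and "0 < e"
    show "0 \<le> Sup (L e)"
    proof (rule ccontr)
      assume "\<not> ?thesis"
      then obtain r where r: "Sup (L e) < ereal r" "ereal r < 0"
        using ereal_dense2[of "Sup (L e)" 0] by (auto simp: not_le)
      then have "0 < - r" by simp
      obtain P where P: "lam ^ P < e"
        using lam_pow_small[OF \<open>0 < e\<close>] .
      obtain n z where z: "1 \<le> n" "z \<in> \<Sigma>" "(shift ^^ n) z = x" "agree P z x" "r < dev A n z"
        using H[rule_format, OF \<open>0 < - r\<close>, of P] by auto
      have "sdist lam z x < e"
        using sdist_le[OF z(4)] P by linarith
      then have "ereal (dev A n z) \<in> L e"
        using z(1-3) unfolding L_def by blast
      then have "ereal (dev A n z) \<le> Sup (L e)"
        by (rule Sup_upper)
      then have "ereal (dev A n z) < ereal r"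
        using r(1) by (rule le_less_trans)
      with z(5) show False by simp
    qed
  qed
  finally show ?thesis
    using x by (simp add: aubry_def)
qed (simp add: aubry_def)

lemma aubry_periodic:
  assumes A: "A \<in> \<C>" and x: "x \<in> aubry d lam A" and \<eta>: "0 < \<eta>"
  obtains n p where "1 \<le> n" "p \<in> \<Sigma>" "(shift ^^ n) p = p" "agree P p x" "- \<eta> < dev A n p"
proof -
  \<comment> \<open>One \<open>Q\<close> serves twice: it makes the closing error at most half of
    \<eta> and keeps the closed orbit \<open>P\<close>-close to \<open>x\<close>.\<close>
  obtain Q where Q: "P \<le> Q" "N A / (1 - \<theta>) * \<theta> ^ Q \<le> \<eta> / 2"
    using theta_pow_small[of "\<eta> / 2" P "N A / (1 - \<theta>)"] \<eta> by auto
  obtain n z where z: "1 \<le> n" "z \<in> \<Sigma>" "(shift ^^ n) z = x" "agree Q z x" "- (\<eta> / 2) < dev A n z"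
    using x[unfolded aubry_iff[OF A]] half_gt_zero[OF \<eta>] by blast
  have "agree Q ((shift ^^ n) z) z"
    using z(3,4) by simp
  note q = closing[OF z(1) this z(2)]
  have "agree (n + Q) z (\<lambda>i. z (i mod n))"
    using q(2) by simp
  from dev_shadowing[OF A z(2) q(3) this order_refl]
  have "- \<eta> < dev A n (\<lambda>i. z (i mod n))"
    using z(5) Q(2) by linarith
  moreover have "agree P (\<lambda>i. z (i mod n)) x"
  proof (intro allI impI)
    fix i assume "i < P"
    then show "z (i mod n) = x i"
      using q(2)[rule_format, of i] z(4)[rule_format, of i] Q(1) by simp
  qed
  ultimately show thesis
    using that[OF z(1) q(3,1)] by blast
qed

section \<open>The support of a maximizing measure lies in the Aubry set\<close>

lemma supp_iff:
  assumes \<mu>: "\<mu> \<in> \<I>"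
  shows "x \<in> supp d lam \<mu> \<longleftrightarrow> x \<in> \<Sigma> \<and> (\<forall>P. 0 < measure \<mu> (cyl d (pre P x)))"
proof -
  interpret prob_space \<mu> by (rule inv_probsD[OF \<mu>])
  have sets: "cyl d w \<in> sets \<mu>" for w
    using cyl_sets inv_probsD(2)[OF \<mu>] by simp
  have cyl: "cyl d (pre P x) = {y \<in> \<Sigma>. agree P x y}" for P
    by (rule cyl_pre)
  have 1: "0 < measure \<mu> (cyl d (pre P x))"
    if "\<forall>e>0. emeasure \<mu> {y \<in> \<Sigma>. sdist lam x y < e} > 0" for P
  proof -
    have "{y \<in> \<Sigma>. sdist lam x y < lam ^ P} \<subseteq> cyl d (pre P x)"
      unfolding cyl using sdist_gt[of P x] by (auto dest: less_asym)
    then have "emeasure \<mu> {y \<in> \<Sigma>. sdist lam x y < lam ^ P} \<le> emeasure \<mu> (cyl d (pre P x))"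
      using sets by (rule emeasure_mono)
    then show ?thesis
      using that lam_pos by (simp add: emeasure_eq_measure) (meson less_le_trans zero_less_power)
  qed
  have 2: "emeasure \<mu> {y \<in> \<Sigma>. sdist lam x y < e} > 0"
    if H: "\<forall>P. 0 < measure \<mu> (cyl d (pre P x))" and e: "0 < e" for e
  proof -
    \<comment> \<open>Distances are 0 or powers of \<open>lam\<close>, so for the least such
      \<open>P\<close> the ball is exactly a cylinder. This matters for measurability:
      \<open>emeasure\<close> of a non-measurable set would be 0 by default.\<close>
    define P where "P = (LEAST P. lam ^ P < e)"
    obtain P' where "lam ^ P' < e"
      using lam_pow_small[OF e] .
    then have P: "lam ^ P < e"
      unfolding P_def by (rule LeastI)
    have "{y \<in> \<Sigma>. sdist lam x y < e} = cyl d (pre P x)"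
      unfolding cyl
    proof (intro Collect_cong conj_cong refl iffI)
      fix y assume "agree P x y"
      from sdist_le[OF this] show "sdist lam x y < e"
        using P by linarith
    next
      fix y assume y: "sdist lam x y < e"
      show "agree P x y"
      proof (rule ccontr)
        assume "\<not> agree P x y"
        then obtain i where i: "i < P" "x i \<noteq> y i" by auto
        then have "lam ^ (LEAST k. x k \<noteq> y k) < e"
          using y by (auto simp: sdist_def split: if_splits)
        then have "P \<le> (LEAST k. x k \<noteq> y k)"
          unfolding P_def by (rule Least_le)
        moreover have "(LEAST k. x k \<noteq> y k) \<le> i"
          using i(2) by (rule Least_le)
        ultimately show False using i(1) by simp
      qed
    qed
    then show ?thesis
      using H by (simp add: emeasure_eq_measure)
  qed
  show ?thesis
    unfolding supp_def using 1 2 by blast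
qed

lemma integral_bsum:
  assumes \<mu>: "\<mu> \<in> \<I>" and f: "f \<in> borel_measurable (BS d)" "\<And>x. x \<in> \<Sigma> \<Longrightarrow> \<bar>f x\<bar> \<le> (M::real)"
  shows "integrable \<mu> (bsum f k)" "integral\<^sup>L \<mu> (bsum f k) = k * integral\<^sup>L \<mu> f"
proof -
  have fm: "f \<in> borel_measurable \<mu>"
    using f(1) measurable_cong_sets[OF inv_probsD(2)[OF \<mu>] refl] by blast
  have int: "integrable \<mu> (\<lambda>x. f ((shift ^^ i) x))" for i
  proof (rule bounded_integrable[OF \<mu>, of _ M])
    show "(\<lambda>x. f ((shift ^^ i) x)) \<in> borel_measurable (BS d)"
      using measurable_compose[OF measurable_compose_n[OF shift_measurable] f(1)] .
  qed (use f(2) Sig_shift in blast)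
  show "integrable \<mu> (bsum f k)"
    unfolding bsum_def by (intro Bochner_Integration.integrable_sum int)
  show "integral\<^sup>L \<mu> (bsum f k) = k * integral\<^sup>L \<mu> f"
    unfolding bsum_def using int integral_shift[OF \<mu> fm]
    by (simp add: Bochner_Integration.integral_sum)
qed

lemma bsum_indicator_first:
  assumes "1 \<le> j" "y \<in> U" "\<And>i. 0 < i \<Longrightarrow> i < j \<Longrightarrow> (shift ^^ i) y \<notin> U"
  shows "bsum (indicator U) j y = (1::real)"
proof -
  have "bsum (indicator U) j y = (\<Sum>i\<in>{0}. indicator U ((shift ^^ i) y) :: real)"
    unfolding bsum_def using assms by (intro sum.mono_neutral_right) auto
  then show ?thesis using assms(2) by simp
qed

lemma bsum_indicator_none:
  assumes "\<And>i. i < j \<Longrightarrow> (shift ^^ i) y \<notin> U"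
  shows "bsum (indicator U) j y = (0::real)"
  unfolding bsum_def using assms by (intro sum.neutral) auto

text \<open>If every return to a cylinder loses at least \<open>c\<close>, then the normalised potential can be
  raised by \<open>c\<close> on that cylinder while its Birkhoff sums stay bounded from above; integration
  shows that the cylinder is null for every maximizing measure.\<close>
lemma returns_lossy_imp_null:
  assumes A: "A \<in> \<C>" and \<mu>: "\<mu> \<in> maxmeas d A" and c: "0 < c"
    and returns: "\<And>y n. y \<in> cyl d w \<Longrightarrow> 1 \<le> n \<Longrightarrow> (shift ^^ n) y \<in> cyl d w \<Longrightarrow> dev A n y \<le> - c"
  shows "measure \<mu> (cyl d w) = 0"
proof -
  let ?U = "cyl d w"
  define C where "C = N A / (1 - \<theta>)"
  define f where "f x = (A x - mA d A) + c * indicator ?U x" for x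
  have \<mu>I: "\<mu> \<in> \<I>" "integral\<^sup>L \<mu> A = mA d A"
    using \<mu> by (auto simp: maxmeas_def)
  interpret prob_space \<mu> by (rule inv_probsD[OF \<mu>I(1)])
  have C0: "0 \<le> C"
    using theta norm_nonneg[OF A] by (simp add: C_def)
  have U: "?U \<subseteq> \<Sigma>" by (auto simp: cyl_def)
  have devC: "dev A n y \<le> C" if "y \<in> \<Sigma>" for n y
    using dev_closing[OF A that, of 0 n C] by (simp add: C_def)
  have f_eq: "bsum f n y = dev A n y + c * bsum (indicator ?U) n y" for n y
    unfolding f_def dev_def by (rule bsum_linear)
  \<comment> \<open>Cut at the next visit. The block before it earns the bonus \<open>c\<close> once
    and loses at least \<open>c\<close>; only the last block, which need not return, can contribute
    up to \<open>C + c\<close>.\<close>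
  have visit: "bsum f k y \<le> C + c" if "y \<in> ?U" for k y
    using that
  proof (induction k arbitrary: y rule: less_induct)
    case (less k)
    show ?case
    proof (cases "\<exists>j. 0 < j \<and> j < k \<and> (shift ^^ j) y \<in> ?U")
      case True
      define j where "j = (LEAST j. 0 < j \<and> j < k \<and> (shift ^^ j) y \<in> ?U)"
      have j: "0 < j" "j < k" "(shift ^^ j) y \<in> ?U"
        using LeastI_ex[OF True] by (auto simp: j_def)
      have first: "(shift ^^ i) y \<notin> ?U" if "0 < i" "i < j" for i
        using not_less_Least[of i "\<lambda>j. 0 < j \<and> j < k \<and> (shift ^^ j) y \<in> ?U"] that j(2)
        by (auto simp: j_def[symmetric])
      have "bsum f k y = bsum f j y + bsum f (k - j) ((shift ^^ j) y)"
        using j by (intro bsum_split) simp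
      moreover have "bsum f j y \<le> 0"
        using returns[OF less.prems _ j(3)] j(1) bsum_indicator_first[OF _ less.prems first, of j]
        by (simp add: f_eq)
      moreover have "bsum f (k - j) ((shift ^^ j) y) \<le> C + c"
        using j by (intro less.IH) auto
      ultimately show ?thesis by linarith
    next
      case False
      show ?thesis
      proof (cases "k = 0")
        case False
        then have "bsum (indicator ?U) k y = (1::real)"
          using \<open>\<nexists>j. _ j\<close> less.prems by (intro bsum_indicator_first) auto
        then show ?thesis
          using devC[of y k] less.prems U by (auto simp: f_eq)
      qed (use C0 c in simp)
    qed
  qed
  \<comment> \<open>The second \<open>C\<close> pays for the stretch before the first visit.\<close>
  have bound: "bsum f k y \<le> 2 * C + c" if y: "y \<in> \<Sigma>" for k y
  proof (cases "\<exists>j. j < k \<and> (shift ^^ j) y \<in> ?U")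
    case True
    define j where "j = (LEAST j. j < k \<and> (shift ^^ j) y \<in> ?U)"
    have j: "j < k" "(shift ^^ j) y \<in> ?U"
      using LeastI_ex[OF True] by (auto simp: j_def)
    have first: "(shift ^^ i) y \<notin> ?U" if "i < j" for i
      using not_less_Least[of i "\<lambda>j. j < k \<and> (shift ^^ j) y \<in> ?U"] that j(1)
      by (auto simp: j_def[symmetric])
    have "bsum f k y = bsum f j y + bsum f (k - j) ((shift ^^ j) y)"
      using j by (intro bsum_split) simp
    moreover have "bsum f j y \<le> C"
      using devC[OF y, of j] bsum_indicator_none[OF first, of j] by (simp add: f_eq)
    moreover have "bsum f (k - j) ((shift ^^ j) y) \<le> C + c"
      using visit[OF j(2)] .
    ultimately show ?thesis by linarith
  next
    case False
    then have "bsum (indicator ?U) k y = (0::real)"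
      by (intro bsum_indicator_none) auto
    then show ?thesis
      using devC[OF y, of k] C0 c by (simp add: f_eq)
  qed
  have fm: "f \<in> borel_measurable (BS d)"
    unfolding f_def using Calpha_measurable[OF A] cyl_sets[of d w] by measurable
  have fb: "\<bar>f x\<bar> \<le> N A + \<bar>mA d A\<bar> + c" for x
  proof -
    have "\<bar>c * indicator ?U x\<bar> \<le> c"
      using c by (simp add: indicator_def)
    then show ?thesis
      using abs_le_norm[OF A, of x] unfolding f_def by linarith
  qed
  have "integral\<^sup>L \<mu> f = c * measure \<mu> ?U"
    unfolding f_def using Calpha_integrable[OF \<mu>I(1) A] cyl_integrable[OF \<mu>I(1), of w]
      integral_cyl[OF \<mu>I(1), of w] \<mu>I(2)
    by (simp add: prob_space)
  \<comment> \<open>By invariance the integral of the k-th Birkhoff sum is linear in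
    \<open>k\<close>, while its values stay bounded above, so the slope cannot be positive.\<close>
  then have "k * (c * measure \<mu> ?U) = integral\<^sup>L \<mu> (bsum f k)" for k :: nat
    using integral_bsum(2)[OF \<mu>I(1) fm fb] by simp
  also have "integral\<^sup>L \<mu> (bsum f k) \<le> 2 * C + c" for k
    using integral_bsum(1)[OF \<mu>I(1) fm fb] bound inv_probsD(3)[OF \<mu>I(1)]
    by (intro integral_le_const) auto
  finally have "real k * (c * measure \<mu> ?U) \<le> 2 * C + c" for k .
  then have "\<not> 0 < c * measure \<mu> ?U"
    using ex_less_of_nat_mult[of "c * measure \<mu> ?U" "2 * C + c"] by (metis leD)
  then show ?thesis
    using c measure_nonneg[of \<mu> ?U] by (simp add: zero_less_mult_iff not_less)
qed

text \<open>If \<open>x\<close> is outside the Aubry set, near returns ending exactly at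
  \<open>x\<close> lose a fixed amount. Shadowing passes half of this loss to all returns to a small
  cylinder around \<open>x\<close>, which is then null, so \<open>x\<close> is not in the
  support.\<close>

lemma supp_subset_aubry:
  assumes A: "A \<in> \<C>" and \<mu>: "\<mu> \<in> maxmeas d A"
  shows "supp d lam \<mu> \<subseteq> aubry d lam A"
proof
  fix x assume "x \<in> supp d lam \<mu>"
  moreover have "\<mu> \<in> \<I>"
    using \<mu> by (simp add: maxmeas_def)
  ultimately have "x \<in> \<Sigma> \<and> (\<forall>P. 0 < measure \<mu> (cyl d (pre P x)))"
    using supp_iff by blast
  then have x: "x \<in> \<Sigma>" "\<And>P. measure \<mu> (cyl d (pre P x)) \<noteq> 0"
    by (blast, metis less_irrefl)
  show "x \<in> aubry d lam A"
  proof (rule ccontr)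
    assume "x \<notin> aubry d lam A"
    then obtain P \<eta> where \<eta>: "0 < \<eta>" and
      H: "\<And>n z. 1 \<le> n \<Longrightarrow> z \<in> \<Sigma> \<Longrightarrow> (shift ^^ n) z = x \<Longrightarrow> agree P z x \<Longrightarrow> dev A n z \<le> - \<eta>"
      unfolding aubry_iff[OF A] using x(1) by (metis not_less)
    obtain Q where Q: "P \<le> Q" "N A / (1 - \<theta>) * \<theta> ^ Q \<le> \<eta> / 2"
      using theta_pow_small[of "\<eta> / 2" P "N A / (1 - \<theta>)"] \<eta> by auto
    have "measure \<mu> (cyl d (pre Q x)) = 0"
    proof (rule returns_lossy_imp_null[OF A \<mu>, of "\<eta> / 2"])
      fix y n assume "y \<in> cyl d (pre Q x)" and n: "1 \<le> n" and "(shift ^^ n) y \<in> cyl d (pre Q x)"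
      then have y: "y \<in> \<Sigma>" "agree Q x y" "agree Q x (\<lambda>k. y (n + k))"
        unfolding cyl_pre funpow_shift by blast+
      \<comment> \<open>Splicing \<open>x\<close> onto the first \<open>n\<close> symbols of
        \<open>y\<close> turns a return to the cylinder into an orbit segment that ends exactly at
        \<open>x\<close>, as the Aubry condition requires.\<close>
      define z where "z i = (if i < n then y i else x (i - n))" for i
      have z: "z \<in> \<Sigma>" "(shift ^^ n) z = x"
        using y(1) x(1) by (auto simp: z_def Sig_def funpow_shift)
      have yz: "agree (n + Q) y z"
      proof (intro allI impI)
        fix i assume "i < n + Q"
        then show "y i = z i"
          using y(3)[rule_format, of "i - n"] by (simp add: z_def)
      qed
      have "agree P z x"
      proof (intro allI impI)
        fix i assume "i < P"
        then show "z i = x i"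
          using yz[rule_format, of i] y(2)[rule_format, of i] Q(1) by simp
      qed
      then have "dev A n z \<le> - \<eta>"
        by (rule H[OF n z])
      then show "dev A n y \<le> - (\<eta> / 2)"
        using dev_shadowing[OF A y(1) z(1) yz order_refl] Q(2) by linarith
    qed (use \<eta> in simp)
    then show False
      using x(2) by blast
  qed
qed


subsection \<open>Perturbing the potential\<close>

lemma cyl_agree: "x \<in> cyl d u \<Longrightarrow> y \<in> \<Sigma> \<Longrightarrow> agree (length u) x y \<Longrightarrow> y \<in> cyl d u"
  by (simp add: mem_cyl)

lemma cyl_both_agree: "x \<in> cyl d u \<Longrightarrow> y \<in> cyl d u \<Longrightarrow> agree (length u) x y"
  by (simp add: mem_cyl)

text \<open>The part of a periodic orbit between its first and its last visit to \<open>cyl d u\<close> is almost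
  a loop, so its contribution is at most \<open>C \<theta>\<^sup>r\<close>; what remains closes up to a periodic
  orbit that visits \<open>cyl d u\<close> only once.\<close>
lemma excise:
  assumes B: "B \<in> \<C>" and C: "N B / (1 - \<theta>) \<le> C"
    and p: "p \<in> \<Sigma>" "1 \<le> n" "(shift ^^ n) p = p" "p \<notin> cyl d u"
  defines "r \<equiv> length u"
  obtains q l t where "q \<in> \<Sigma>" "1 \<le> l" "(shift ^^ l) q = q" "t < l" "agree r ((shift ^^ t) q) p"
    "bsum (indicator (cyl d u)) l q \<le> (1::real)" "dev B n p - 2 * C * \<theta> ^ r \<le> dev B l q"
proof (cases "\<exists>i<n. (shift ^^ i) p \<in> cyl d u")
  case False
  have "0 \<le> C"
    using C theta norm_nonneg[OF B] by (meson divide_nonneg_pos diff_gt_0_iff_gt order_trans)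
  then have "dev B n p - 2 * C * \<theta> ^ r \<le> dev B n p"
    using theta by simp
  moreover have "bsum (indicator (cyl d u)) n p = (0::real)"
    using False by (intro bsum_indicator_none) blast
  ultimately show thesis
    using that[of p n 0] p by simp
next
  case True
  let ?U = "cyl d u"
  define V where "V = {i. i < n \<and> (shift ^^ i) p \<in> ?U}"
  define a where "a = Min V"
  define b where "b = Max V"
  have V: "finite V" "V \<noteq> {}"
    using True by (auto simp: V_def)
  have aV: "a \<in> V" and bV: "b \<in> V"
    using V by (simp_all add: a_def b_def)
  have a_min: "a \<le> i" and b_max: "i \<le> b" if "i \<in> V" for i
    using V that by (simp_all add: a_def b_def)
  \<comment> \<open>Time 0 is no visit because \<open>p\<close> avoids the cylinder. Hence the kept
    arc passes through \<open>p\<close> at time \<open>n - b\<close>, strictly before its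
    end.\<close>
  have a0: "a \<noteq> 0"
    using aV p(4) by (intro notI) (simp add: V_def)
  have ab: "a \<le> b" "a < n" "b < n" "(shift ^^ a) p \<in> ?U" "(shift ^^ b) p \<in> ?U"
    using aV bV a_min by (auto simp: V_def)
  \<comment> \<open>The kept arc runs from the last visit \<open>b\<close> through the end of the
    period up to the first visit \<open>a\<close> of the next one.\<close>
  define y where "y = (shift ^^ b) p"
  define l where "l = n - b + a"
  have per: "p (n + i) = p i" for i
    using fun_cong[OF p(3), of i] by (simp add: funpow_shift)
  have l: "1 \<le> l" "n - b < l"
    using a0 ab by (auto simp: l_def)
  have y: "y \<in> \<Sigma>" "y \<in> ?U"
    using Sig_shift[OF p(1)] ab(5) by (simp_all add: y_def)
  have sl: "(shift ^^ l) y = (shift ^^ a) p"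
  proof
    fix i
    have "p (b + (l + i)) = p (n + (a + i))"
      using ab by (intro arg_cong[of _ _ p]) (simp add: l_def)
    then show "(shift ^^ l) y i = (shift ^^ a) p i"
      by (simp add: y_def funpow_shift per)
  qed
  have sn: "(shift ^^ (n - b)) y = p"
  proof
    fix i
    have "p (b + (n - b + i)) = p (n + i)"
      using ab by (intro arg_cong[of _ _ p]) simp
    then show "(shift ^^ (n - b)) y i = p i"
      by (simp add: y_def funpow_shift per)
  qed
  have loop: "agree r ((shift ^^ l) y) y"
    unfolding sl r_def using ab(4) y(2) by (rule cyl_both_agree)
  define q where "q = (\<lambda>i. y (i mod l))"
  note q = closing[OF l(1) loop y(1), folded q_def]
  have yq: "agree (l + r) y q"
    using q(2) by (simp add: q_def)
  have qy: "agree r ((shift ^^ j) q) ((shift ^^ j) y)" if "j \<le> l" for j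
  proof (intro allI impI)
    fix i assume "i < r"
    then show "(shift ^^ j) q i = (shift ^^ j) y i"
      using yq[rule_format, of "j + i"] that by (simp add: funpow_shift)
  qed
  have "agree r ((shift ^^ (n - b)) q) p"
    using qy[of "n - b"] l(2) by (simp add: sn)
  \<comment> \<open>Strictly inside the arc the times lie after \<open>b\<close> or, reduced modulo
    \<open>n\<close>, before \<open>a\<close>, so none is a visit. Agreement on \<open>r\<close>
    symbols transfers this from \<open>y\<close> to \<open>q\<close>.\<close>
  moreover have "bsum (indicator ?U) l q = (1::real)"
  proof (rule bsum_indicator_first[OF l(1)])
    show "q \<in> ?U"
      using cyl_agree[OF y(2) q(3)] yq by (simp add: r_def)
    fix j assume j: "0 < j" "j < l"
    have "(shift ^^ j) y \<notin> ?U"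
    proof (cases "b + j < n")
      case True
      have "(shift ^^ j) y = (shift ^^ (b + j)) p"
        by (simp add: y_def funpow_shift add.assoc)
      then show ?thesis
        using b_max[of "b + j"] j(1) True by (auto simp: V_def)
    next
      case False
      have "(shift ^^ j) y = (shift ^^ (b + j - n)) p"
      proof
        fix i
        have "p (b + (j + i)) = p (n + (b + j - n + i))"
          using False by (intro arg_cong[of _ _ p]) simp
        then show "(shift ^^ j) y i = (shift ^^ (b + j - n)) p i"
          by (simp add: y_def funpow_shift per)
      qed
      moreover have "b + j - n < a"
        using j(2) False ab by (simp add: l_def)
      ultimately show ?thesis
        using a_min[of "b + j - n"] ab(2) by (auto simp: V_def)
    qed
    moreover have "agree r ((shift ^^ j) q) ((shift ^^ j) y)"
      using j(2) by (intro qy) simp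
    ultimately show "(shift ^^ j) q \<notin> ?U"
      using cyl_agree[of "(shift ^^ j) q" u "(shift ^^ j) y"] Sig_shift[OF y(1)] unfolding r_def by blast
  qed
  \<comment> \<open>One error \<open>C * \<theta> ^ r\<close> comes from the removed loop, the other
    from closing the arc.\<close>
  moreover have "dev B n p - 2 * C * \<theta> ^ r \<le> dev B l q"
  proof -
    have s1: "(shift ^^ (b - a)) ((shift ^^ a) p) = y"
      using ab(1) by (simp add: y_def funpow_shift)
    have "agree r ((shift ^^ (b - a)) ((shift ^^ a) p)) ((shift ^^ a) p)"
      unfolding s1 r_def using y(2) ab(4) by (rule cyl_both_agree)
    from dev_closing[OF B Sig_shift[OF p(1)] this C]
    have mid: "dev B (b - a) ((shift ^^ a) p) \<le> C * \<theta> ^ r" .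
    have "dev B n p = dev B a p + dev B (n - a) ((shift ^^ a) p)"
      unfolding dev_def using ab by (intro bsum_split) simp
    moreover have "dev B (n - a) ((shift ^^ a) p) = dev B (b - a) ((shift ^^ a) p) + dev B (n - b) y"
      unfolding dev_def using ab bsum_split[of "b - a" "n - a" _ "(shift ^^ a) p"] s1 by simp
    moreover have "dev B l y = dev B (n - b) y + dev B a p"
      unfolding dev_def l_def bsum_add sn ..
    moreover have "dev B l y \<le> dev B l q + C * \<theta> ^ r"
      by (rule dev_shadowing[OF B y(1) q(3) yq C])
    ultimately show ?thesis
      using mid by linarith
  qed
  ultimately show thesis
    using that[OF q(3) l(1) q(1) l(2)] by simp
qed

text \<open>Here \<psi> is the penalty function, \<open>m\<close> stands for the maximum at the
  centre of the ball, and \<delta> absorbs the perturbation. The shadowing orbit loses less than a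
  quarter of \<epsilon> and excision costs at most another quarter, while one passage near
  \<open>p\<close> costs \<epsilon>. The other half of \<epsilon> must thus come from the
  perturbation, which is impossible.\<close>

lemma aubry_avoids_penalty:
  assumes B: "B \<in> \<C>" and C: "N B / (1 - \<theta>) \<le> C"
    and \<psi>: "\<psi> \<in> \<C>" "\<And>x. 0 \<le> \<psi> x" "\<And>x y. x \<in> \<Sigma> \<Longrightarrow> y \<in> \<Sigma> \<Longrightarrow> agree k x y \<Longrightarrow> \<psi> x = \<psi> y"
    and u: "k \<le> length u" "\<And>x. x \<in> cyl d u \<Longrightarrow> \<psi> x < 1"
    and pos: "0 < \<kappa>" "0 < c" "0 < \<epsilon>" "8 * C * \<theta> ^ length u \<le> \<epsilon>"
    and \<delta>: "8 * \<delta> \<le> \<kappa> * c\<^sup>2" "8 * \<delta> \<le> \<epsilon> * c"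
    and m: "m - \<delta> \<le> mA d B"
    and gap: "\<And>\<nu>. \<nu> \<in> \<I> \<Longrightarrow> integral\<^sup>L \<nu> B
      \<le> m + \<delta> - \<kappa> * (c - measure \<nu> (cyl d u))\<^sup>2 - \<epsilon> * integral\<^sup>L \<nu> \<psi>"
    and x: "x \<in> aubry d lam B"
  shows "\<psi> x < 1"
proof (rule ccontr)
  let ?r = "length u"
  assume "\<not> ?thesis"
  then have \<psi>x: "1 \<le> \<psi> x" by simp
  have x\<Sigma>: "x \<in> \<Sigma>"
    using x by (simp add: aubry_def)
  obtain n p where p: "1 \<le> n" "p \<in> \<Sigma>" "(shift ^^ n) p = p" "agree k p x" "- (\<epsilon> / 4) < dev B n p"
    using aubry_periodic[OF B x, of "\<epsilon> / 4" k] pos(3) by auto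
  have \<psi>p: "1 \<le> \<psi> p"
    using \<psi>(3)[OF p(2) x\<Sigma> p(4)] \<psi>x by simp
  then have pU: "p \<notin> cyl d u"
    using u(2)[of p] by (meson not_less)
  obtain q l t where q: "q \<in> \<Sigma>" "1 \<le> l" "(shift ^^ l) q = q" "t < l" "agree ?r ((shift ^^ t) q) p"
    "bsum (indicator (cyl d u)) l q \<le> (1::real)" "dev B n p - 2 * C * \<theta> ^ ?r \<le> dev B l q"
    using excise[OF B C p(2,1,3) pU] .
  let ?\<nu> = "orbit_measure l q"
  have \<nu>: "?\<nu> \<in> \<I>"
    using orbit_measure_inv(1)[OF q(1-3)] .
  have l0: "0 < real l" using q(2) by simp
  \<comment> \<open>As \<open>k\<close> is at most the length of \<open>u\<close>, the excised orbit
    still meets the penalised k-cylinder of \<open>p\<close>.\<close>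
  have "agree k ((shift ^^ t) q) p"
    using q(5) u(1) by simp
  then have "1 \<le> \<psi> ((shift ^^ t) q)"
    using \<psi>(3)[OF Sig_shift[OF q(1)] p(2)] \<psi>p by simp
  also have "\<dots> \<le> bsum \<psi> l q"
    unfolding bsum_def using q(4) \<psi>(2) by (intro member_le_sum) auto
  finally have "1 \<le> l * integral\<^sup>L ?\<nu> \<psi>"
    using orbit_measure_integral[OF q(1,2) Calpha_measurable[OF \<psi>(1)]] l0 by simp
  then have \<epsilon>\<psi>: "\<epsilon> \<le> l * (\<epsilon> * integral\<^sup>L ?\<nu> \<psi>)"
    using mult_left_mono[of 1 "l * integral\<^sup>L ?\<nu> \<psi>" \<epsilon>] pos(3) by (simp add: mult.left_commute)
  let ?v = "measure ?\<nu> (cyl d u)"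
  have v: "l * ?v \<le> 1"
    using orbit_measure_inv(2)[OF q(1-3), of u] q(6) l0 by simp
  have "dev B l q = l * integral\<^sup>L ?\<nu> B - l * mA d B"
    using orbit_measure_integral[OF q(1,2) Calpha_measurable[OF B]] l0 by (simp add: dev_eq)
  also have "\<dots> \<le> l * (m + \<delta> - \<kappa> * (c - ?v)\<^sup>2 - \<epsilon> * integral\<^sup>L ?\<nu> \<psi>) - l * (m - \<delta>)"
    using gap[OF \<nu>] m by (intro diff_mono mult_left_mono) auto
  also have "\<dots> = l * (2 * \<delta> - \<kappa> * (c - ?v)\<^sup>2) - l * (\<epsilon> * integral\<^sup>L ?\<nu> \<psi>)"
    by (simp add: algebra_simps)
  finally have "dev B l q \<le> l * (2 * \<delta> - \<kappa> * (c - ?v)\<^sup>2) - \<epsilon>"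
    using \<epsilon>\<psi> by linarith
  then have key: "\<epsilon> / 2 < l * (2 * \<delta> - \<kappa> * (c - ?v)\<^sup>2)"
    using q(7) p(5) pos(4) by linarith
  show False
  \<comment> \<open>On a long orbit a single visit means frequency at most \<open>c / 2\<close>, and
    the quadratic gap absorbs \<open>2 * \<delta>\<close> per step. On a short orbit the whole
    perturbation adds up to at most half of \<epsilon>.\<close>
  proof (cases "2 \<le> l * c")
    case True
    have "l * (c / 2) \<le> l * (c - ?v)"
      using v True by (simp add: algebra_simps)
    then have "c / 2 \<le> c - ?v"
      using l0 by simp
    then have "(c / 2)\<^sup>2 \<le> (c - ?v)\<^sup>2"
      using pos(2) by (intro power_mono) auto
    then have "\<kappa> * (c / 2)\<^sup>2 \<le> \<kappa> * (c - ?v)\<^sup>2"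
      using pos(1) by (intro mult_left_mono) auto
    then have "2 * \<delta> - \<kappa> * (c - ?v)\<^sup>2 \<le> 0"
      using \<delta>(1) by (simp add: power_divide)
    then have "l * (2 * \<delta> - \<kappa> * (c - ?v)\<^sup>2) \<le> 0"
      using l0 by (simp add: mult_nonneg_nonpos)
    then show False using key pos(3) by linarith
  next
    case False
    have "l * (2 * \<delta> - \<kappa> * (c - ?v)\<^sup>2) \<le> l * (2 * \<delta>)"
      using pos(1) by (intro mult_left_mono) auto
    also have "\<dots> \<le> l * (\<epsilon> * c / 4)"
      using \<delta>(2) by (intro mult_left_mono) auto
    also have "\<dots> = (l * c) * (\<epsilon> / 4)"
      by simp
    also have "\<dots> \<le> 2 * (\<epsilon> / 4)"
      using False pos(3) by (intro mult_right_mono) auto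
    finally show False using key by simp
  qed
qed

text \<open>One shape for both perturbations: weighted by the masses of \<mu> it is, up to the
  factor \<open>2 * \<kappa>\<close>, the derivative of the convex term; with weights 0 and 1 it is
  the penalty.\<close>

definition step :: "nat list set \<Rightarrow> (nat list \<Rightarrow> real) \<Rightarrow> (nat \<Rightarrow> nat) \<Rightarrow> real" where
  "step W a x = (\<Sum>w\<in>W. a w * indicator (cyl d w) x)"

lemma step_agree:
  assumes "\<And>w. w \<in> W \<Longrightarrow> length w \<le> n" "x \<in> \<Sigma>" "y \<in> \<Sigma>" "agree n x y"
  shows "step W a x = step W a y"
  unfolding step_def
proof (rule sum.cong[OF refl])
  fix w assume "w \<in> W"
  then have "length w \<le> n" by (rule assms(1))
  then have "x \<in> cyl d w \<longleftrightarrow> y \<in> cyl d w"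
    using assms(2-4) by (auto simp: mem_cyl)
  then show "a w * indicator (cyl d w) x = a w * indicator (cyl d w) y"
    by (simp add: indicator_def)
qed

lemma step_Calpha:
  assumes W: "\<And>w. w \<in> W \<Longrightarrow> length w \<le> n" and a: "\<And>w. w \<in> W \<Longrightarrow> 0 \<le> a w \<and> a w \<le> 1"
  shows "step W a \<in> \<C>" "N (step W a) \<le> card W * (1 + 2 / \<theta> ^ n)" "0 \<le> step W a x"
proof -
  show nonneg: "0 \<le> step W a x" for x
    unfolding step_def using a by (intro sum_nonneg) simp
  have bound: "\<bar>step W a x\<bar> \<le> card W" for x
  proof -
    have "step W a x \<le> (\<Sum>w\<in>W. 1)"
      unfolding step_def using a by (intro sum_mono) (simp add: indicator_def)
    then show ?thesis using nonneg[of x] by simp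
  qed
  have zero: "step W a x = 0" if "x \<notin> \<Sigma>" for x
    unfolding step_def using that by (intro sum.neutral) (simp add: cyl_def)
  show "step W a \<in> \<C>" "N (step W a) \<le> card W * (1 + 2 / \<theta> ^ n)"
    using Calpha_locally_constant[of "step W a" "real (card W)" n, OF zero bound]
      step_agree[of W n _ _ a, OF W] by blast+
qed

lemma step_integral:
  assumes "\<mu> \<in> \<I>"
  shows "integral\<^sup>L \<mu> (step W a) = (\<Sum>w\<in>W. a w * measure \<mu> (cyl d w))"
  unfolding step_def using cyl_integrable[OF assms] integral_cyl[OF assms]
  by (simp add: Bochner_Integration.integral_sum)

text \<open>If \<open>\<mu>\<close> maximizes \<open>\<nu> \<mapsto> \<integral>A d\<nu> + \<kappa> \<Sum>\<nu>[w]\<^sup>2\<close>, then adding the derivative at \<open>\<mu>\<close> of the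
  strictly convex term to \<open>A\<close> makes \<open>\<mu>\<close> maximizing with a quadratic gap, because
  \<open>2ab = a\<^sup>2 + b\<^sup>2 - (a - b)\<^sup>2\<close>.\<close>
lemma exists_exposing_perturbation:
  assumes A: "A \<in> \<C>" and W: "finite W"
  obtains \<mu> where "\<mu> \<in> \<I>" "\<And>\<nu>. \<nu> \<in> \<I> \<Longrightarrow>
    integral\<^sup>L \<nu> (\<lambda>x. A x + 2 * \<kappa> * step W (\<lambda>w. measure \<mu> (cyl d w)) x)
    \<le> integral\<^sup>L \<mu> (\<lambda>x. A x + 2 * \<kappa> * step W (\<lambda>w. measure \<mu> (cyl d w)) x)
      - \<kappa> * (\<Sum>w\<in>W. (measure \<mu> (cyl d w) - measure \<nu> (cyl d w))\<^sup>2)"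
proof -
  define s where "s \<nu> w = measure \<nu> (cyl d w)" for \<nu> w
  obtain \<mu> where \<mu>: "\<mu> \<in> \<I>" "\<And>\<nu>. \<nu> \<in> \<I> \<Longrightarrow>
      integral\<^sup>L \<nu> A + \<kappa> * (\<Sum>w\<in>W. (s \<nu> w)\<^sup>2) \<le> integral\<^sup>L \<mu> A + \<kappa> * (\<Sum>w\<in>W. (s \<mu> w)\<^sup>2)"
    using exists_maximizer[OF A W, of \<kappa>] unfolding s_def by blast
  have int: "integral\<^sup>L \<nu> (\<lambda>x. A x + 2 * \<kappa> * step W (s \<mu>) x)
      = integral\<^sup>L \<nu> A + 2 * \<kappa> * (\<Sum>w\<in>W. s \<mu> w * s \<nu> w)" if "\<nu> \<in> \<I>" for \<nu>
  proof -
    have "integrable \<nu> (step W (s \<mu>))"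
      unfolding step_def
      by (intro Bochner_Integration.integrable_sum integrable_mult_right cyl_integrable that)
    then show ?thesis
      using Calpha_integrable[OF that A] step_integral[OF that, of W "s \<mu>"] by (simp add: s_def)
  qed
  have "integral\<^sup>L \<nu> (\<lambda>x. A x + 2 * \<kappa> * step W (s \<mu>) x)
    \<le> integral\<^sup>L \<mu> (\<lambda>x. A x + 2 * \<kappa> * step W (s \<mu>) x) - \<kappa> * (\<Sum>w\<in>W. (s \<mu> w - s \<nu> w)\<^sup>2)"
    if \<nu>: "\<nu> \<in> \<I>" for \<nu>
  proof -
    have sq: "(\<Sum>w\<in>W. (s \<mu> w - s \<nu> w)\<^sup>2)
        = (\<Sum>w\<in>W. (s \<mu> w)\<^sup>2) + (\<Sum>w\<in>W. (s \<nu> w)\<^sup>2) - 2 * (\<Sum>w\<in>W. s \<mu> w * s \<nu> w)"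
      by (simp add: power2_diff sum.distrib sum_subtractf sum_distrib_left mult.assoc)
    have "\<kappa> * (\<Sum>w\<in>W. (s \<mu> w - s \<nu> w)\<^sup>2) = \<kappa> * (\<Sum>w\<in>W. (s \<mu> w)\<^sup>2) + \<kappa> * (\<Sum>w\<in>W. (s \<nu> w)\<^sup>2)
        - 2 * \<kappa> * (\<Sum>w\<in>W. s \<mu> w * s \<nu> w)"
      unfolding sq by (simp add: algebra_simps)
    moreover have "(\<Sum>w\<in>W. s \<mu> w * s \<mu> w) = (\<Sum>w\<in>W. (s \<mu> w)\<^sup>2)"
      by (simp add: power2_eq_square)
    ultimately show ?thesis
      using \<mu>(2)[OF \<nu>] int[OF \<nu>] int[OF \<mu>(1)] by simp
  qed
  then show thesis
    using that[OF \<mu>(1)] unfolding s_def by blast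
qed


text \<open>Both goals weakened to precision \<open>k\<close>, so that they can hold on whole balls
  of potentials, where several maximizing measures may coexist. Validity for all \<open>k\<close>
  forces uniqueness and puts the Aubry set inside the support.\<close>

definition separated :: "nat \<Rightarrow> ((nat \<Rightarrow> nat) \<Rightarrow> real) \<Rightarrow> bool" where
  "separated k B \<longleftrightarrow>
    (\<forall>\<mu>\<in>maxmeas d B. \<forall>x\<in>aubry d lam B. 0 < measure \<mu> (cyl d (pre k x))) \<and>
    (\<forall>\<mu>\<in>maxmeas d B. \<forall>\<nu>\<in>maxmeas d B. \<forall>w. length w \<le> k \<longrightarrow>
      \<bar>measure \<mu> (cyl d w) - measure \<nu> (cyl d w)\<bar> \<le> 1 / Suc k)"

lemma separated_all_imp:
  assumes B: "B \<in> \<C>" and sep: "\<And>k. separated k B"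
  shows "\<exists>\<mu>. maxmeas d B = {\<mu>} \<and> aubry d lam B = supp d lam \<mu>"
proof -
  obtain \<mu> where \<mu>: "\<mu> \<in> maxmeas d B"
    using maxmeas_nonempty[OF B] .
  then have \<mu>I: "\<mu> \<in> \<I>" by (simp add: maxmeas_def)
  have "\<nu> = \<mu>" if \<nu>: "\<nu> \<in> maxmeas d B" for \<nu>
  proof (rule measure_eqI_cyl[of _ d])
    have \<nu>I: "\<nu> \<in> \<I>" using \<nu> by (simp add: maxmeas_def)
    show "prob_space \<nu>" "sets \<nu> = sets (BS d)" "prob_space \<mu>" "sets \<mu> = sets (BS d)"
      using inv_probsD(1,2) \<nu>I \<mu>I by blast+
    fix w
    show "measure \<nu> (cyl d w) = measure \<mu> (cyl d w)"
    proof (rule ccontr)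
      assume "\<not> ?thesis"
      then obtain k where k: "k \<noteq> 0" "inverse (real k) < \<bar>measure \<nu> (cyl d w) - measure \<mu> (cyl d w)\<bar>"
        using ex_inverse_of_nat_less[of "\<bar>measure \<nu> (cyl d w) - measure \<mu> (cyl d w)\<bar>"] by auto
      \<comment> \<open>Taking the maximum with \<open>length w\<close> brings \<open>w\<close> into
        the range of the condition and only sharpens the bound.\<close>
      have "\<bar>measure \<nu> (cyl d w) - measure \<mu> (cyl d w)\<bar> \<le> 1 / Suc (max k (length w))"
        using sep[of "max k (length w)"] \<mu> \<nu> unfolding separated_def by (meson max.cobounded2)
      also have "\<dots> \<le> inverse (real k)"
        unfolding inverse_eq_divide using k(1) by (intro divide_left_mono) auto
      finally show False using k(2) by linarith
    qed
  qed
  then have "maxmeas d B = {\<mu>}"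
    using \<mu> by blast
  moreover have "aubry d lam B \<subseteq> supp d lam \<mu>"
  proof
    fix x assume x: "x \<in> aubry d lam B"
    then have "x \<in> \<Sigma>" by (simp add: aubry_def)
    moreover have "0 < measure \<mu> (cyl d (pre P x))" for P
      using sep[of P] \<mu> x by (simp add: separated_def)
    ultimately show "x \<in> supp d lam \<mu>"
      by (simp add: supp_iff[OF \<mu>I])
  qed
  ultimately show ?thesis
    using supp_subset_aubry[OF B \<mu>] by blast
qed

section \<open>Density of the approximate conditions\<close>

lemma cyl_prefix_mono:
  assumes "x \<in> cyl d u" "k \<le> length u" "\<mu> \<in> \<I>"
  shows "measure \<mu> (cyl d u) \<le> measure \<mu> (cyl d (pre k x))"
proof -
  interpret prob_space \<mu> by (rule inv_probsD[OF assms(3)])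
  have "cyl d u \<subseteq> cyl d (pre k x)"
    using assms(1,2) unfolding cyl_pre by (auto simp: mem_cyl)
  then show ?thesis
    using cyl_sets inv_probsD(2)[OF assms(3)] by (intro finite_measure_mono) auto
qed

lemma exists_charged_word:
  assumes \<mu>: "\<mu> \<in> \<I>"
  obtains u where "u \<in> words r" "0 < measure \<mu> (cyl d u)"
proof -
  have "(\<Sum>w\<in>pre r ` \<Sigma>. measure \<mu> (cyl d w)) = measure \<mu> \<Sigma>"
    using inv_probsD(1,2)[OF \<mu>] by (intro measure_clopen[symmetric]) auto
  also have "\<dots> = 1"
    using prob_space.prob_space[OF inv_probsD(1)[OF \<mu>]] inv_probsD(3)[OF \<mu>] by simp
  finally obtain w where "w \<in> pre r ` \<Sigma>" "measure \<mu> (cyl d w) \<noteq> 0"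
    by (metis (no_types, lifting) sum.neutral zero_neq_one)
  then show thesis
    using that[of w] pre_words[of _ d r] measure_nonneg[of \<mu> "cyl d w"] by fastforce
qed

text \<open>The condition \<open>separated\<close> ranges over all lists, whereas the gap controls
  only words over the alphabet; the other lists have empty cylinders.\<close>

lemma cyl_empty: "\<not> set w \<subseteq> {1..d} \<Longrightarrow> cyl d w = {}"
proof (rule ccontr)
  assume w: "\<not> set w \<subseteq> {1..d}" and "cyl d w \<noteq> {}"
  then obtain x where "x \<in> \<Sigma>" "pre (length w) x = w"
    unfolding cyl_def by blast
  then show False
    using pre_words[of x d "length w"] w by metis
qed

text \<open>Applied to the masses of \<mu>: a measure whose masses on \<open>W\<close> differ from
  these by less than \<tau> charges every word of \<open>W\<close> that \<mu> charges.\<close>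

lemma finite_pos_lower_bound:
  fixes f :: "'a \<Rightarrow> real"
  assumes "finite W" "0 < t"
  obtains \<tau> where "0 < \<tau>" "\<tau> \<le> t" "\<And>w. w \<in> W \<Longrightarrow> 0 < f w \<Longrightarrow> \<tau> \<le> f w"
proof
  let ?S = "insert t (f ` {w \<in> W. 0 < f w})"
  show "0 < Min ?S" "Min ?S \<le> t" "\<And>w. w \<in> W \<Longrightarrow> 0 < f w \<Longrightarrow> Min ?S \<le> f w"
    using assms by auto
qed

lemma separated_dense:
  assumes A0: "A0 \<in> \<C>" and e: "0 < e"
  obtains A \<delta> where "A \<in> \<C>" "N (\<lambda>x. A x - A0 x) < e" "0 < \<delta>"
    "\<And>B. B \<in> \<C> \<Longrightarrow> N (\<lambda>x. B x - A x) < \<delta> \<Longrightarrow> separated k B"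
proof -
  \<comment> \<open>The denominator comes from the norm bound for step functions of level
    \<open>k\<close>, so the penalty moves the potential by at most \<open>e / 4\<close>. Adding 1
    to the cardinality keeps the denominator positive.\<close>
  define \<epsilon> where "\<epsilon> = e / (4 * ((real (card (words k)) + 1) * (1 + 2 / \<theta> ^ k)))"
  have "0 < 1 + 2 / \<theta> ^ n" for n
    using theta by (simp add: add_pos_pos)
  note Q = this
  have \<epsilon>: "0 < \<epsilon>"
    using e Q[of k] by (simp add: \<epsilon>_def)
  \<comment> \<open>\<open>N A0 + e + 1\<close> bounds the norm throughout the final ball: its
    centre is within \<open>e / 2\<close> of \<open>A0\<close> and its radius is at most 1.\<close>
  define C where "C = (N A0 + e + 1) / (1 - \<theta>)"
  obtain r where r: "k \<le> r" "8 * C * \<theta> ^ r \<le> \<epsilon>"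
    using theta_pow_small[OF \<epsilon>, of k "8 * C"] .
  define W where "W = {w. set w \<subseteq> {1..d} \<and> length w \<le> r}"
  have W: "finite W" "\<And>w. w \<in> W \<Longrightarrow> length w \<le> r"
    by (auto simp: W_def intro: finite_lists_length_le)
  \<comment> \<open>The 8 in place of 4 offsets the factor 2 in the derivative of the
    squares.\<close>
  define \<kappa> where "\<kappa> = e / (8 * ((real (card W) + 1) * (1 + 2 / \<theta> ^ r)))"
  have \<kappa>: "0 < \<kappa>"
    using e Q[of r] by (simp add: \<kappa>_def)
  obtain \<mu> where \<mu>: "\<mu> \<in> \<I>" and gap0: "\<And>\<nu>. \<nu> \<in> \<I> \<Longrightarrow>
    integral\<^sup>L \<nu> (\<lambda>x. A0 x + 2 * \<kappa> * step W (\<lambda>w. measure \<mu> (cyl d w)) x)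
    \<le> integral\<^sup>L \<mu> (\<lambda>x. A0 x + 2 * \<kappa> * step W (\<lambda>w. measure \<mu> (cyl d w)) x)
      - \<kappa> * (\<Sum>w\<in>W. (measure \<mu> (cyl d w) - measure \<nu> (cyl d w))\<^sup>2)"
    by (rule exists_exposing_perturbation[OF A0 W(1), where \<kappa> = \<kappa>]) blast
  interpret prob_space \<mu> by (rule inv_probsD[OF \<mu>])
  define g where "g = step W (\<lambda>w. measure \<mu> (cyl d w))"
  \<comment> \<open>The indicator of the union of the \<mu>-null cylinders of length
    \<open>k\<close>. Its \<mu>-integral is 0, so \<mu> stays maximizing, with value
    \<open>m\<close>, when a multiple of it is subtracted.\<close>
  define \<psi> where "\<psi> = step (words k) (\<lambda>w. if measure \<mu> (cyl d w) = 0 then 1 else 0)"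
  define A1 where "A1 x = A0 x + 2 * \<kappa> * g x" for x
  define A where "A x = A1 x - \<epsilon> * \<psi> x" for x
  define m where "m = integral\<^sup>L \<mu> A1"
  define D where "D \<nu> = (\<Sum>w\<in>W. (measure \<mu> (cyl d w) - measure \<nu> (cyl d w))\<^sup>2)" for \<nu>
  have gap1: "integral\<^sup>L \<nu> A1 \<le> m - \<kappa> * D \<nu>" if "\<nu> \<in> \<I>" for \<nu>
    using gap0[OF that] by (simp add: m_def A1_def[abs_def] g_def D_def)
  have g: "g \<in> \<C>" "N g \<le> card W * (1 + 2 / \<theta> ^ r)"
    unfolding g_def using step_Calpha(1,2)[OF W(2), of W] by auto
  have \<psi>: "\<psi> \<in> \<C>" "N \<psi> \<le> card (words k) * (1 + 2 / \<theta> ^ k)" "\<And>x. 0 \<le> \<psi> x"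
    unfolding \<psi>_def using step_Calpha[of "words k" k] by auto
  have \<psi>_agree: "\<psi> x = \<psi> y" if "x \<in> \<Sigma>" "y \<in> \<Sigma>" "agree k x y" for x y
    unfolding \<psi>_def by (rule step_agree[OF _ that]) simp
  have \<psi>_int: "integral\<^sup>L \<mu> \<psi> = 0"
    unfolding \<psi>_def step_integral[OF \<mu>] by (intro sum.neutral) simp
  have \<psi>_null: "1 \<le> \<psi> x" if "x \<in> \<Sigma>" "measure \<mu> (cyl d (pre k x)) = 0" for x
  proof -
    have "(1::real) = (if measure \<mu> (cyl d (pre k x)) = 0 then 1 else 0) * indicator (cyl d (pre k x)) x"
      using that by (simp add: cyl_pre)
    also have "\<dots> \<le> \<psi> x"
      unfolding \<psi>_def step_def using pre_words[OF that(1), of k] finite_words[of d k]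
      by (intro member_le_sum) (auto simp: indicator_def)
    finally show ?thesis by simp
  qed
  have \<psi>_charged: "\<psi> x = 0" if "0 < measure \<mu> (cyl d (pre k x))" for x
    unfolding \<psi>_def step_def
  proof (rule sum.neutral, rule ballI)
    fix w assume w: "w \<in> words k"
    have "w = pre k x" if "x \<in> cyl d w"
      using that w by (simp add: cyl_def)
    then show "(if measure \<mu> (cyl d w) = 0 then 1 else 0) * indicator (cyl d w) x = (0::real)"
      using that by (auto simp: indicator_def)
  qed
  have A1: "A1 \<in> \<C>"
    unfolding A1_def using Calpha_add(1)[OF A0 Calpha_scale(1)[OF g(1)]] .
  have A: "A \<in> \<C>"
    unfolding A_def using Calpha_diff(1)[OF A1 Calpha_scale(1)[OF \<psi>(1)]] .
  have dist: "N (\<lambda>x. A x - A0 x) \<le> e / 2"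
  proof -
    have frac: "e / (K * ((real n + 1) * q)) * (real n * q) \<le> e / K"
      if "0 < q" "0 < K" for n :: nat and q K :: real
    proof -
      have "e / (K * ((real n + 1) * q)) * (real n * q) \<le> e / (K * ((real n + 1) * q)) * ((real n + 1) * q)"
        using e that by (intro mult_left_mono mult_right_mono) auto
      also have "\<dots> = e / K"
        using that by simp
      finally show ?thesis .
    qed
    have "N (\<lambda>x. A x - A0 x) = N (\<lambda>x. 2 * \<kappa> * g x - \<epsilon> * \<psi> x)"
      by (simp add: A_def A1_def)
    also have "\<dots> \<le> N (\<lambda>x. 2 * \<kappa> * g x) + N (\<lambda>x. \<epsilon> * \<psi> x)"
      by (intro Calpha_diff Calpha_scale g \<psi>)
    also have "\<dots> \<le> \<bar>2 * \<kappa>\<bar> * N g + \<bar>\<epsilon>\<bar> * N \<psi>"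
      by (intro add_mono Calpha_scale g \<psi>)
    also have "\<dots> \<le> 2 * (\<kappa> * (card W * (1 + 2 / \<theta> ^ r))) + \<epsilon> * (card (words k) * (1 + 2 / \<theta> ^ k))"
      using \<kappa> \<epsilon> g(2) \<psi>(2) by (intro add_mono) auto
    also have "\<dots> \<le> 2 * (e / 8) + e / 4"
    proof (intro add_mono mult_left_mono)
      show "\<kappa> * (card W * (1 + 2 / \<theta> ^ r)) \<le> e / 8"
        unfolding \<kappa>_def by (rule frac[OF Q]) simp
      show "\<epsilon> * (card (words k) * (1 + 2 / \<theta> ^ k)) \<le> e / 4"
        unfolding \<epsilon>_def by (rule frac[OF Q]) simp
    qed simp
    finally show ?thesis by simp
  qed
  \<comment> \<open>Any charged word of length \<open>r\<close> will do; its prefix of length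
    \<open>k\<close> is charged too, so the penalty vanishes on its cylinder.\<close>
  obtain u where u: "u \<in> words r" "0 < measure \<mu> (cyl d u)"
    using exists_charged_word[OF \<mu>] .
  define c where "c = measure \<mu> (cyl d u)"
  have c: "0 < c" using u(2) by (simp add: c_def)
  have uW: "u \<in> W" using u(1) by (auto simp: W_def)
  \<comment> \<open>Half of \<open>1 / Suc k\<close>, because two maximizing measures are compared
    through \<mu>.\<close>
  obtain \<tau> where \<tau>: "0 < \<tau>" "\<tau> \<le> 1 / (2 * Suc k)"
    "\<And>w. w \<in> W \<Longrightarrow> 0 < measure \<mu> (cyl d w) \<Longrightarrow> \<tau> \<le> measure \<mu> (cyl d w)"
    using finite_pos_lower_bound[OF W(1), of "1 / (2 * Suc k)" "\<lambda>w. measure \<mu> (cyl d w)"] by auto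
  \<comment> \<open>The 1 serves \<open>C\<close>, the next two entries serve
    \<open>aubry_avoids_penalty\<close>, and the last forces \<open>D \<nu> < \<tau>\<^sup>2\<close>
    for every maximizing \<nu>.\<close>
  define \<delta> where "\<delta> = min 1 (min (\<kappa> * c\<^sup>2 / 8) (min (\<epsilon> * c / 8) (\<kappa> * \<tau>\<^sup>2 / 4)))"
  have \<delta>: "0 < \<delta>" "\<delta> \<le> 1" "8 * \<delta> \<le> \<kappa> * c\<^sup>2" "8 * \<delta> \<le> \<epsilon> * c" "4 * \<delta> \<le> \<kappa> * \<tau>\<^sup>2"
    using \<kappa> \<epsilon> c \<tau>(1) by (simp_all add: \<delta>_def min_le_iff_disj)
  have "separated k B" if B: "B \<in> \<C>" "N (\<lambda>x. B x - A x) < \<delta>" for B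
  proof -
    have h: "(\<lambda>x. B x - A x) \<in> \<C>"
      by (intro Calpha_diff B A)
    have int_B: "\<bar>integral\<^sup>L \<nu> B - (integral\<^sup>L \<nu> A1 - \<epsilon> * integral\<^sup>L \<nu> \<psi>)\<bar> \<le> \<delta>" if \<nu>: "\<nu> \<in> \<I>" for \<nu>
    proof -
      have "integral\<^sup>L \<nu> (\<lambda>x. B x - A x) = integral\<^sup>L \<nu> B - (integral\<^sup>L \<nu> A1 - \<epsilon> * integral\<^sup>L \<nu> \<psi>)"
        using Calpha_integrable[OF \<nu>] B(1) A A1 \<psi>(1) by (simp add: A_def)
      then show ?thesis
        using integral_bounds[OF \<nu> h abs_le_norm[OF h]] B(2) by linarith
    qed
    have gapB: "integral\<^sup>L \<nu> B \<le> m + \<delta> - \<kappa> * D \<nu> - \<epsilon> * integral\<^sup>L \<nu> \<psi>" if "\<nu> \<in> \<I>" for \<nu>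
      using int_B[OF that] gap1[OF that] by linarith
    have mB: "m - \<delta> \<le> mA d B"
      using int_B[OF \<mu>] integral_le_mA[OF B(1) \<mu>] \<psi>_int by (simp add: m_def)
    have term_le: "(measure \<mu> (cyl d w) - measure \<nu> (cyl d w))\<^sup>2 \<le> D \<nu>" if "w \<in> W" for w \<nu>
      unfolding D_def using W(1) that by (intro member_le_sum) auto
    have close: "\<bar>measure \<mu> (cyl d w) - measure \<nu> (cyl d w)\<bar> < \<tau>"
      if \<nu>: "\<nu> \<in> maxmeas d B" and w: "w \<in> W" for \<nu> w
    proof -
      have \<nu>': "\<nu> \<in> \<I>" "integral\<^sup>L \<nu> B = mA d B"
        using \<nu> by (auto simp: maxmeas_def)
      have "0 \<le> \<epsilon> * integral\<^sup>L \<nu> \<psi>"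
        using \<epsilon> \<psi>(3) by simp
      then have "\<kappa> * D \<nu> \<le> 2 * \<delta>"
        using gapB[OF \<nu>'(1)] mB \<nu>'(2) by linarith
      also have "\<dots> < \<kappa> * \<tau>\<^sup>2"
        using \<delta>(1,5) by linarith
      finally have "D \<nu> < \<tau>\<^sup>2"
        using \<kappa> by simp
      then have "(measure \<mu> (cyl d w) - measure \<nu> (cyl d w))\<^sup>2 < \<tau>\<^sup>2"
        using term_le[OF w, of \<nu>] by linarith
      then show ?thesis
        using \<tau>(1) power2_less_imp_less[of "\<bar>measure \<mu> (cyl d w) - measure \<nu> (cyl d w)\<bar>" \<tau>] by simp
    qed
    have NB: "N B / (1 - \<theta>) \<le> C"
    proof -
      have "N B \<le> N (\<lambda>x. B x - A x) + N A"
        using Calpha_add(2)[OF h A] by simp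
      moreover have "N A \<le> N (\<lambda>x. A x - A0 x) + N A0"
        using Calpha_add(2)[OF Calpha_diff(1)[OF A A0] A0] by simp
      ultimately have "N B \<le> N A0 + e + 1"
        using B(2) dist \<delta>(2) e by linarith
      then show ?thesis
        unfolding C_def using theta by (intro divide_right_mono) auto
    qed
    have charged: "0 < measure \<mu> (cyl d (pre k x))" if x: "x \<in> aubry d lam B" for x
    proof -
      have x\<Sigma>: "x \<in> \<Sigma>" using x by (simp add: aubry_def)
      have "\<psi> x < 1"
      proof (rule aubry_avoids_penalty[OF B(1) NB \<psi>(1,3) \<psi>_agree, where u = u and c = c and m = m and \<delta> = \<delta>])
        show "k \<le> length u" "8 * C * \<theta> ^ length u \<le> \<epsilon>"
          using r u(1) by auto
        show "\<psi> y < 1" if "y \<in> cyl d u" for y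
          using \<psi>_charged[of y] cyl_prefix_mono[OF that _ \<mu>, of k] r(1) u by simp
        show "integral\<^sup>L \<nu> B \<le> m + \<delta> - \<kappa> * (c - measure \<nu> (cyl d u))\<^sup>2 - \<epsilon> * integral\<^sup>L \<nu> \<psi>"
          if "\<nu> \<in> \<I>" for \<nu>
          using gapB[OF that] mult_left_mono[OF term_le[OF uW, of \<nu>] less_imp_le[OF \<kappa>]]
          unfolding c_def by linarith
      qed (use \<kappa> c \<epsilon> \<delta> mB x in auto)
      then show ?thesis
        using \<psi>_null[OF x\<Sigma>] measure_nonneg[of \<mu> "cyl d (pre k x)"] by linarith
    qed
    show ?thesis
      unfolding separated_def
    proof (intro conjI ballI allI impI)
      fix \<nu> x assume \<nu>: "\<nu> \<in> maxmeas d B" and x: "x \<in> aubry d lam B"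
      then have "pre k x \<in> W"
        using pre_words[of x d k] r(1) by (simp add: W_def aubry_def)
      from close[OF \<nu> this] \<tau>(3)[OF this charged[OF x]] show "0 < measure \<nu> (cyl d (pre k x))"
        by linarith
    next
      fix \<nu> \<nu>' and w :: "nat list" assume \<nu>: "\<nu> \<in> maxmeas d B" "\<nu>' \<in> maxmeas d B" and w: "length w \<le> k"
      show "\<bar>measure \<nu> (cyl d w) - measure \<nu>' (cyl d w)\<bar> \<le> 1 / Suc k"
      proof (cases "set w \<subseteq> {1..d}")
        case True
        then have wW: "w \<in> W" using w r(1) by (simp add: W_def)
        have "2 * \<tau> \<le> 1 / Suc k"
          using \<tau>(2) by (simp add: field_simps)
        then show ?thesis
          using close[OF \<nu>(1) wW] close[OF \<nu>(2) wW] by linarith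
      qed (simp add: cyl_empty)
    qed
  qed
  then show thesis
    using that[OF A _ \<delta>(1)] dist e by simp
qed

lemma contains_residual_unique_aubry:
  "contains_residual \<C> N {A \<in> \<C>. \<exists>\<mu>. maxmeas d A = {\<mu>} \<and> aubry d lam A = supp d lam \<mu>}"
proof -
  \<comment> \<open>The interior of the set of potentials with \<open>separated k\<close>, so that
    openness is immediate; the centres from \<open>separated_dense\<close> lie in it, which gives
    density.\<close>
  define G where "G k = {A \<in> \<C>. \<exists>e>0. \<forall>B\<in>\<C>. N (\<lambda>x. B x - A x) < e \<longrightarrow> separated k B}" for k
  have tri: "N (\<lambda>x. B x - A x) \<le> N (\<lambda>x. B x - A' x) + N (\<lambda>x. A' x - A x)"
    if "A \<in> \<C>" "A' \<in> \<C>" "B \<in> \<C>" for A A' B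
    using Calpha_add(2)[OF Calpha_diff(1)[OF that(3,2)] Calpha_diff(1)[OF that(2,1)]] by simp
  have "\<exists>e>0. \<forall>B\<in>\<C>. N (\<lambda>x. B x - A x) < e \<longrightarrow> B \<in> G k" if AG: "A \<in> G k" for A k
  proof -
    obtain e where e: "0 < e" "\<And>B. B \<in> \<C> \<Longrightarrow> N (\<lambda>x. B x - A x) < e \<Longrightarrow> separated k B"
      using AG unfolding G_def by blast
    have A: "A \<in> \<C>" using AG by (simp add: G_def)
    have "B \<in> G k" if B: "B \<in> \<C>" "N (\<lambda>x. B x - A x) < e / 2" for B
    proof -
      have "separated k B'" if "B' \<in> \<C>" "N (\<lambda>x. B' x - B x) < e / 2" for B'
        using e(2)[OF that(1)] tri[OF A B(1) that(1)] that(2) B(2) by linarith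
      then show ?thesis
        using B(1) e(1) unfolding G_def by (blast intro: half_gt_zero)
    qed
    then show ?thesis
      using half_gt_zero[OF e(1)] by blast
  qed
  moreover have "\<exists>B\<in>G k. N (\<lambda>x. B x - A x) < e" if Ae: "A \<in> \<C>" "0 < e" for A e k
  proof -
    obtain B \<delta> where "B \<in> \<C>" "N (\<lambda>x. B x - A x) < e" "0 < \<delta>"
      "\<And>B'. B' \<in> \<C> \<Longrightarrow> N (\<lambda>x. B' x - B x) < \<delta> \<Longrightarrow> separated k B'"
      by (rule separated_dense[OF Ae, of k]) blast
    then show ?thesis
      unfolding G_def by blast
  qed
  moreover have "(\<Inter>k. G k) \<subseteq> {A \<in> \<C>. \<exists>\<mu>. maxmeas d A = {\<mu>} \<and> aubry d lam A = supp d lam \<mu>}"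
  proof
    fix A assume A: "A \<in> (\<Inter>k. G k)"
    then have AC: "A \<in> \<C>" by (simp add: G_def)
    have zero: "N (\<lambda>x. A x - A x) = 0"
      using CalphaI(2)[of "\<lambda>_. 0" 0 0] CalphaI(1)[of "\<lambda>_. 0" 0 0] norm_nonneg[of "\<lambda>_. 0"] by simp
    have "separated k A" for k
    proof -
      have "A \<in> G k" using A by blast
      then obtain e where "0 < e" "\<forall>B\<in>\<C>. N (\<lambda>x. B x - A x) < e \<longrightarrow> separated k B"
        unfolding G_def by blast
      then show ?thesis
        using AC zero by simp
    qed
    then show "A \<in> {A \<in> \<C>. \<exists>\<mu>. maxmeas d A = {\<mu>} \<and> aubry d lam A = supp d lam \<mu>}"
      using separated_all_imp[OF AC] AC by blast
  qed
  moreover have "G k \<subseteq> \<C>" for k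
    by (auto simp: G_def)
  ultimately show ?thesis
    unfolding contains_residual_def by (intro exI[of _ G] conjI allI ballI impI) simp_all
qed

end

theorem mainTheorem15:
  fixes d :: nat and lam \<alpha> :: real
  assumes "1 \<le> d" and "0 < lam" and "lam < 1" and "0 < \<alpha>"
  shows "contains_residual (Calpha d lam \<alpha>) (holder_norm d lam \<alpha>)
           {A \<in> Calpha d lam \<alpha>. \<exists>\<mu>. maxmeas d A = {\<mu>} \<and> aubry d lam A = supp d lam \<mu>}"
proof -
  interpret hoelder_shift d lam \<alpha>
    using assms by unfold_locales
  show ?thesis
    by (rule contains_residual_unique_aubry)
qed

end
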